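(* Let $H$ be a separable infinite-dimensional complex Hilbert space and let $\alpha:\mathbb{N}_0\to[0,\infty)$ be a monotone increasing function with $\alpha(0)=0$ and $\alpha(1)>0$. Let $\psi_\alpha$ be the non-linear trace of Sugeno type associated with $\alpha$, and define $\|a\|_\alpha:=\psi_\alpha(|a|)$ for $a\in K(H)$. Assume that $\alpha$ is concave in the sense that $\frac{\alpha(i+1)+\alpha(i-1)}{2}\le\alpha(i)$ for $i=1,2,3,\dots$. Then $\|\cdot\|_\alpha$ satisfies the triangle inequality: for any $b,c\in K(H)$, $$\|b+c\|_\alpha\le\|b\|_\alpha+\|c\|_\alpha.$$
   Context: $\mathbb{N}_0=\{0,1,2,\dots\}$; $\vee$ denotes maximum (or supremum) and $\wedge$ minimum. $K(H)$ is the algebra of compact operators on $H$, $K(H)^+$ its positive elements, $|a|=(a^*a)^{1/2}$. For $a\in K(H)^+$, $\lambda_1(a)\ge\lambda_2(a)\ge\cdots$ denotes the sequence of nonzero eigenvalues of $a$ in decreasing order counted with multiplicity (completed by zeros if $a$ has finite rank). The non-linear trace of Sugeno type associated with $\alpha$ is $\psi_\alpha(a)=\bigvee_{i=1}^\infty(\lambda_i(a)\wedge\alpha(i))$ for $a\in K(H)^+$. *)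

theory Defs
  imports "HOL-Analysis.Analysis"
begin

text \<open>The inner product is linear in the first and conjugate-linear in the second argument.\<close>

class complex_hilbert_space = banach +
  fixes scaleC :: "complex \<Rightarrow> 'a \<Rightarrow> 'a"
    and cinner :: "'a \<Rightarrow> 'a \<Rightarrow> complex"
  assumes scaleC_add_right: "scaleC c (x + y) = scaleC c x + scaleC c y"
    and scaleC_add_left: "scaleC (c + d) x = scaleC c x + scaleC d x"
    and scaleC_scaleC: "scaleC c (scaleC d x) = scaleC (c * d) x"
    and scaleC_one: "scaleC 1 x = x"
    and scaleR_scaleC: "scaleR r x = scaleC (complex_of_real r) x"
    and cinner_commute: "cinner x y = cnj (cinner y x)"
    and cinner_add_left: "cinner (x + y) z = cinner x z + cinner y z"
    and cinner_scaleC_left: "cinner (scaleC c x) y = c * cinner x y"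
    and cinner_self_nonneg: "0 \<le> Re (cinner x x)"
    and cinner_self_eq_zero: "cinner x x = 0 \<longleftrightarrow> x = 0"
    and norm_eq_sqrt_cinner: "norm x = sqrt (Re (cinner x x))"

global_interpretation complex_vector:
  vector_space "scaleC :: complex \<Rightarrow> 'a \<Rightarrow> 'a::complex_hilbert_space"
  defines cspan = complex_vector.span
    and cdim = complex_vector.dim
  by unfold_locales (simp_all add: scaleC_add_right scaleC_add_left scaleC_scaleC scaleC_one)

abbreviation clinear :: "('a::complex_hilbert_space \<Rightarrow> 'a) \<Rightarrow> bool" where
  "clinear \<equiv> Vector_Spaces.linear scaleC scaleC"

definition bounded_clinear :: "('a::complex_hilbert_space \<Rightarrow> 'a) \<Rightarrow> bool" where
  "bounded_clinear a \<longleftrightarrow> clinear a \<and> (\<exists>K. \<forall>x. norm (a x) \<le> K * norm x)"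

definition compact_operators :: "('a::complex_hilbert_space \<Rightarrow> 'a) set" where
  "compact_operators = {a. clinear a \<and> compact (closure (a ` cball 0 1))}"

definition positive_operator :: "('a::complex_hilbert_space \<Rightarrow> 'a) \<Rightarrow> bool" where
  "positive_operator a \<longleftrightarrow>
     bounded_clinear a \<and> (\<forall>x. cinner (a x) x \<in> \<real> \<and> 0 \<le> Re (cinner (a x) x))"

definition adj :: "('a::complex_hilbert_space \<Rightarrow> 'a) \<Rightarrow> 'a \<Rightarrow> 'a" where
  "adj a = (THE b. \<forall>x y. cinner (a x) y = cinner x (b y))"

definition operator_sqrt :: "('a::complex_hilbert_space \<Rightarrow> 'a) \<Rightarrow> 'a \<Rightarrow> 'a" where
  "operator_sqrt a = (THE p. positive_operator p \<and> p \<circ> p = a)"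

definition operator_abs :: "('a::complex_hilbert_space \<Rightarrow> 'a) \<Rightarrow> 'a \<Rightarrow> 'a" where
  "operator_abs a = operator_sqrt (adj a \<circ> a)"

definition eigenspace :: "('a::complex_hilbert_space \<Rightarrow> 'a) \<Rightarrow> complex \<Rightarrow> 'a set" where
  "eigenspace a t = {x. a x = scaleC t x}"

text \<open>
  The sequence \<open>\<mu>\<close> lists the nonzero eigenvalues of a compact positive operator in decreasing
  order: every \<open>t > 0\<close> occurs exactly as often as its multiplicity says (in particular not at all
  if it is not an eigenvalue), and the remaining entries, if any, are zero. Positive operators have
  only nonnegative eigenvalues, so real entries suffice; compactness makes the multiplicities
  finite and makes such a sequence exist, and it is then unique.
\<close>

definition is_eigenvalue_sequence ::
    "('a::complex_hilbert_space \<Rightarrow> 'a) \<Rightarrow> (nat \<Rightarrow> real) \<Rightarrow> bool" where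
  "is_eigenvalue_sequence a \<mu> \<longleftrightarrow>
     decseq \<mu> \<and> (\<forall>i. 0 \<le> \<mu> i) \<and>
     (\<forall>t>0. finite {i. \<mu> i = t} \<and>
            card {i. \<mu> i = t} = cdim (eigenspace a (complex_of_real t)))"

text \<open>The eigenvalues are indexed from 1, so the value at index 0 is immaterial.\<close>

definition eigenvalue :: "('a::complex_hilbert_space \<Rightarrow> 'a) \<Rightarrow> nat \<Rightarrow> real" where
  "eigenvalue a i = (THE \<mu>. is_eigenvalue_sequence a \<mu>) (i - 1)"

definition sugeno_trace ::
    "(nat \<Rightarrow> real) \<Rightarrow> ('a::complex_hilbert_space \<Rightarrow> 'a) \<Rightarrow> real" where
  "sugeno_trace \<alpha> a = (SUP i\<in>{1..}. min (eigenvalue a i) (\<alpha> i))"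

definition sugeno_norm ::
    "(nat \<Rightarrow> real) \<Rightarrow> ('a::complex_hilbert_space \<Rightarrow> 'a) \<Rightarrow> real" where
  "sugeno_norm \<alpha> a = sugeno_trace \<alpha> (operator_abs a)"

end

theory Submission
  imports Defs
begin

text \<open>
  Let \<open>s\<^sub>1 \<ge> s\<^sub>2 \<ge> \<dots>\<close> denote singular values, \<open>B = \<parallel>b\<parallel>\<^sub>\<alpha>\<close> and \<open>C = \<parallel>c\<parallel>\<^sub>\<alpha>\<close>. If \<open>m\<close> singular values of
  \<open>b\<close> exceed \<open>B\<close>, then \<open>\<alpha>(m) \<le> B\<close>; likewise \<open>\<alpha>(n) \<le> C\<close> for the number \<open>n\<close> of singular values of \<open>c\<close>
  exceeding \<open>C\<close>. The Weyl--Fan inequality gives \<open>s\<^sub>i(b + c) \<le> B + C\<close> for \<open>i > m + n\<close>, while for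
  \<open>i \<le> m + n\<close> monotonicity and concavity give \<open>\<alpha>(i) \<le> \<alpha>(m + n) \<le> \<alpha>(m) + \<alpha>(n) \<le> B + C\<close>.

  The singular vectors \<open>e\<^sub>i\<close> of a compact \<open>a\<close> are found one after the other by maximising \<open>\<parallel>a x\<parallel>\<close> on the
  unit sphere of the orthogonal complement of the previous ones; then \<open>|a|\<close> is the diagonal operator
  with entries \<open>\<parallel>a e\<^sub>i\<parallel>\<close>.
\<close>

section \<open>Inner products\<close>

lemma cinner_add_right: "cinner x (y + z) = cinner x y + cinner x (z::'a::complex_hilbert_space)"
  by (metis cinner_add_left cinner_commute complex_cnj_add)

lemma cinner_scaleC_right:
  "cinner x (scaleC c y) = cnj c * cinner x (y::'a::complex_hilbert_space)"
  by (metis cinner_scaleC_left cinner_commute complex_cnj_mult)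

lemma cinner_zero_left [simp]: "cinner 0 (x::'a::complex_hilbert_space) = 0"
  by (metis add_cancel_right_left cinner_add_left)

lemma cinner_zero_right [simp]: "cinner (x::'a::complex_hilbert_space) 0 = 0"
  by (metis add_cancel_right_left cinner_add_right)

lemma cinner_minus_left: "cinner (- x) (y::'a::complex_hilbert_space) = - cinner x y"
  by (metis add.right_inverse add_eq_0_iff cinner_add_left cinner_zero_left)

lemma cinner_minus_right: "cinner x (- y::'a::complex_hilbert_space) = - cinner x y"
  by (metis add.right_inverse add_eq_0_iff cinner_add_right cinner_zero_right)

lemma cinner_diff_left: "cinner (x - y) (z::'a::complex_hilbert_space) = cinner x z - cinner y z"
  by (metis cinner_add_left cinner_minus_left diff_conv_add_uminus)

lemma cinner_diff_right: "cinner x (y - z::'a::complex_hilbert_space) = cinner x y - cinner x z"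
  by (metis cinner_add_right cinner_minus_right diff_conv_add_uminus)

lemma cinner_sum_left:
  "cinner (\<Sum>i\<in>I. f i) (x::'a::complex_hilbert_space) = (\<Sum>i\<in>I. cinner (f i) x)"
  by (induction I rule: infinite_finite_induct) (auto simp: cinner_add_left)

lemma cinner_sum_right:
  "cinner (x::'a::complex_hilbert_space) (\<Sum>i\<in>I. f i) = (\<Sum>i\<in>I. cinner x (f i))"
  by (induction I rule: infinite_finite_induct) (auto simp: cinner_add_right)

lemma cinner_self: "cinner x x = complex_of_real ((norm (x::'a::complex_hilbert_space))\<^sup>2)"
proof -
  have "Im (cinner x x) = 0"
    using cinner_commute[of x x] by (metis cnj.simps(2) equal_neg_zero)
  then show ?thesis
    by (simp add: complex_eq_iff norm_eq_sqrt_cinner cinner_self_nonneg)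
qed

lemma cinner_eq_zero_commute:
  "cinner x y = 0 \<longleftrightarrow> cinner y (x::'a::complex_hilbert_space) = 0"
  by (metis cinner_commute complex_cnj_zero_iff)

lemma power2_norm_add:
  "(norm (x + y))\<^sup>2 = (norm x)\<^sup>2 + (norm y)\<^sup>2 + 2 * Re (cinner x (y::'a::complex_hilbert_space))"
proof -
  have "complex_of_real ((norm (x + y))\<^sup>2) = cinner x x + cinner y y + (cinner x y + cnj (cinner x y))"
    using cinner_commute[of y x] by (simp only: cinner_self[symmetric] cinner_add_left cinner_add_right ac_simps)
  then have "Re (complex_of_real ((norm (x + y))\<^sup>2))
      = Re (cinner x x + cinner y y + (cinner x y + cnj (cinner x y)))"
    by simp
  then show ?thesis
    by (simp add: cinner_self del: of_real_power)
qed

lemma power2_norm_diff: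
  "(norm (x - y))\<^sup>2 = (norm x)\<^sup>2 + (norm y)\<^sup>2 - 2 * Re (cinner x (y::'a::complex_hilbert_space))"
  using power2_norm_add[of x "- y"] by (simp add: cinner_minus_right)

lemma mult_cnj_eq: "z * cnj z = (complex_of_real (cmod z))\<^sup>2"
  using complex_norm_square[of z] by simp

lemma norm_scaleC: "norm (scaleC c x) = cmod c * norm (x::'a::complex_hilbert_space)"
proof -
  have "complex_of_real ((norm (scaleC c x))\<^sup>2) = complex_of_real ((cmod c * norm x)\<^sup>2)"
    unfolding cinner_self[symmetric] cinner_scaleC_left cinner_scaleC_right
    by (simp add: cinner_self mult_cnj_eq power_mult_distrib mult.commute[of _ c] flip: mult.assoc)
  then show ?thesis
    by (metis norm_ge_zero of_real_eq_iff power2_eq_imp_eq zero_le_mult_iff)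
qed

text \<open>By Pythagoras, the projection of \<open>x\<close> onto \<open>y\<close> is no longer
  than \<open>x\<close>; this is Cauchy-Schwarz.\<close>

lemma norm_cinner_le: "cmod (cinner x y) \<le> norm x * norm (y::'a::complex_hilbert_space)"
proof (cases "y = 0")
  case False
  let ?c = "cinner x y / cinner y y"
  let ?z = "x - scaleC ?c y"
  have yy: "cinner y y \<noteq> 0"
    using False cinner_self_eq_zero by blast
  have "cinner ?z y = 0"
    using yy by (simp add: cinner_diff_left cinner_scaleC_left)
  then have "Re (cinner ?z (scaleC ?c y)) = 0"
    by (simp add: cinner_scaleC_right)
  then have "(norm x)\<^sup>2 = (norm ?z)\<^sup>2 + (norm (scaleC ?c y))\<^sup>2"
    using power2_norm_add[of ?z "scaleC ?c y"] by simp
  then have "norm (scaleC ?c y) \<le> norm x"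
    by (simp add: power2_le_imp_le)
  moreover have "norm (scaleC ?c y) = cmod (cinner x y) / norm y"
    using False by (simp add: norm_scaleC cinner_self norm_divide norm_mult power2_eq_square)
  ultimately show ?thesis
    using False by (simp add: divide_simps)
qed simp

lemma bounded_linear_cinner_left:
  "bounded_linear (\<lambda>x. cinner x (y::'a::complex_hilbert_space))"
  by (rule bounded_linear_intro[where K = "norm y"])
     (auto simp: cinner_add_left scaleR_scaleC cinner_scaleC_left norm_cinner_le scaleR_conv_of_real)

lemma bounded_linear_scaleC_right:
  "bounded_linear (\<lambda>x::'a::complex_hilbert_space. scaleC c x)"
  by (rule bounded_linear_intro[where K = "cmod c"])
     (auto simp: scaleC_add_right scaleR_scaleC scaleC_scaleC norm_scaleC ac_simps)

lemma cinner_eqI: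
  assumes "\<And>x. cinner x y = cinner x (z::'a::complex_hilbert_space)"
  shows "y = z"
  using assms[of "y - z"] cinner_self_eq_zero[of "y - z"] by (simp add: cinner_diff_right)

lemma clinear_iff:
  "clinear a \<longleftrightarrow> (\<forall>x y. a (x + y) = a x + a y) \<and> (\<forall>c x. a (scaleC c x) = scaleC c (a x))"
  by (simp add: Vector_Spaces.linear_iff complex_vector.vector_space_axioms)

lemma
  assumes "clinear a"
  shows clinear_add: "a (x + y) = a x + a y"
    and clinear_scaleC: "a (scaleC c x) = scaleC c (a x)"
    and clinear_zero: "a 0 = 0"
    and clinear_diff: "a (x - y) = a x - a y"
    and clinear_sum: "a (\<Sum>i\<in>I. f i) = (\<Sum>i\<in>I. a (f i))"
proof -
  show add: "a (x + y) = a x + a y" for x y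
    using assms by (simp add: clinear_iff)
  show "a (scaleC c x) = scaleC c (a x)" for c x
    using assms by (simp add: clinear_iff)
  show zero: "a 0 = 0"
    using add[of 0 0] by simp
  show "a (x - y) = a x - a y"
    using add[of "x - y" y] by simp
  show "a (\<Sum>i\<in>I. f i) = (\<Sum>i\<in>I. a (f i))"
    by (induction I rule: infinite_finite_induct) (auto simp: add zero)
qed

section \<open>The adjoint\<close>

text \<open>The representing vector minimises \<open>\<parallel>u\<parallel>\<^sup>2 - 2 Re (\<phi> u)\<close>; by the parallelogram law
  every minimising sequence is Cauchy.\<close>

lemma Riesz_representation:
  fixes \<phi> :: "'a::complex_hilbert_space \<Rightarrow> complex"
  assumes add: "\<And>x y. \<phi> (x + y) = \<phi> x + \<phi> y"
    and scale: "\<And>c x. \<phi> (scaleC c x) = c * \<phi> x"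
    and bound: "\<And>x. cmod (\<phi> x) \<le> K * norm x"
  shows "\<exists>u. \<forall>x. \<phi> x = cinner x u"
proof -
  define J where "J u = (norm u)\<^sup>2 - 2 * Re (\<phi> u)" for u
  have lower: "- K\<^sup>2 \<le> J u" for u
  proof -
    have "Re (\<phi> u) \<le> K * norm u"
      using bound[of u] complex_Re_le_cmod[of "\<phi> u"] by linarith
    moreover have "0 \<le> (norm u - K)\<^sup>2" by simp
    ultimately show ?thesis
      by (simp add: J_def power2_diff algebra_simps)
  qed
  define m where "m = Inf (range J)"
  have bdd: "bdd_below (range J)"
    using lower by (intro bdd_belowI2) auto
  have m_le: "m \<le> J u" for u
    unfolding m_def using bdd by (intro cInf_lower) auto
  have "\<exists>u. J u < m + 1 / Suc n" for n
    using cInf_lessD[of "range J" "m + 1 / Suc n"] by (auto simp: m_def)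
  then obtain u where u: "\<And>n. J (u n) < m + 1 / Suc n"
    by metis
  have phi_scaleR: "\<phi> (scaleR r x) = of_real r * \<phi> x" for r x
    by (simp add: scaleR_scaleC scale)
  \<comment> \<open>\<open>J\<close> is at least \<open>m\<close> at the midpoint of
    \<open>x\<close> and \<open>y\<close>; with the parallelogram law this bounds the distance
    between near-minimisers.\<close>
  have par: "(norm (x - y))\<^sup>2 \<le> 2 * J x + 2 * J y - 4 * m" for x y
  proof -
    have "J (scaleR (1/2) (x + y)) = (norm (x + y))\<^sup>2 / 4 - Re (\<phi> x) - Re (\<phi> y)"
      unfolding J_def phi_scaleR by (simp add: add power_divide add_divide_distrib)
    then have "m \<le> (norm (x + y))\<^sup>2 / 4 - Re (\<phi> x) - Re (\<phi> y)"
      using m_le by metis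
    moreover have "(norm (x + y))\<^sup>2 + (norm (x - y))\<^sup>2 = 2 * (norm x)\<^sup>2 + 2 * (norm y)\<^sup>2"
      by (simp add: power2_norm_add power2_norm_diff)
    ultimately show ?thesis
      by (simp add: J_def)
  qed
  have "Cauchy u"
  proof (rule metric_CauchyI)
    fix e :: real assume "0 < e"
    \<comment> \<open>If both \<open>J\<close>-values are below \<open>m + e\<^sup>2 / 4\<close>,
      the bound in \<open>par\<close> is below \<open>e\<^sup>2\<close>.\<close>
    then obtain N where N: "1 / Suc N < e\<^sup>2 / 4"
      using nat_approx_posE[of "e\<^sup>2 / 4"] by (metis zero_less_divide_iff zero_less_numeral zero_less_power)
    have close: "J (u i) < m + e\<^sup>2 / 4" if "i \<ge> N" for i
    proof (rule less_trans[OF u])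
      have "1 / real (Suc i) \<le> 1 / Suc N" using that by (simp add: frac_le)
      then show "m + 1 / real (Suc i) < m + e\<^sup>2 / 4"
        using le_less_trans[OF _ N] by (intro add_strict_left_mono)
    qed
    have "dist (u i) (u j) < e" if "i \<ge> N" "j \<ge> N" for i j
    proof -
      note par
      also have "2 * J (u i) + 2 * J (u j) - 4 * m < e\<^sup>2"
        using close[OF that(1)] close[OF that(2)] by linarith
      finally have "(norm (u i - u j))\<^sup>2 < e\<^sup>2" .
      then show ?thesis
        using \<open>0 < e\<close> by (simp add: dist_norm power2_less_imp_less)
    qed
    then show "\<exists>M. \<forall>i\<ge>M. \<forall>j\<ge>M. dist (u i) (u j) < e" by blast
  qed
  then obtain v where v: "u \<longlonglongrightarrow> v"
    using Cauchy_convergent convergentD by blast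
  have "bounded_linear \<phi>"
    by (rule bounded_linear_intro[where K = K])
       (auto simp: add phi_scaleR bound scaleR_conv_of_real mult.commute)
  then have "(\<lambda>n. J (u n)) \<longlonglongrightarrow> J v"
    unfolding J_def by (intro tendsto_intros v bounded_linear.tendsto[of \<phi>])
  moreover have "(\<lambda>n. m + 1 / Suc n) \<longlonglongrightarrow> m"
    using tendsto_add[OF tendsto_const LIMSEQ_Suc[OF lim_1_over_n]] by simp
  ultimately have "J v \<le> m"
    using u by (intro LIMSEQ_le) (auto intro: less_imp_le)
  then have min: "J v \<le> J x" for x
    using m_le order_trans by blast
  \<comment> \<open>First variation: \<open>J\<close> along the line \<open>v + t h\<close> is
    minimal at \<open>t = 0\<close>, which forces its linear coefficient \<open>2 * ?d\<close> to
    vanish.\<close>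
  have Re_eq: "Re (cinner h v) = Re (\<phi> h)" for h
  proof -
    let ?d = "Re (cinner v h) - Re (\<phi> h)"
    have quad: "0 \<le> t\<^sup>2 * (norm h)\<^sup>2 + 2 * t * ?d" for t
    proof -
      have "J (v + scaleR t h) = J v + t\<^sup>2 * (norm h)\<^sup>2 + 2 * t * ?d"
        unfolding J_def add phi_scaleR power2_norm_add
        by (simp add: scaleR_scaleC cinner_scaleC_right norm_scaleC power_mult_distrib algebra_simps)
      then show ?thesis using min[of "v + scaleR t h"] by linarith
    qed
    \<comment> \<open>Adding 1 keeps the divisor positive even for \<open>h = 0\<close>; the choice
      \<open>t = - ?d / ?q\<close> then contradicts \<open>quad\<close> unless
      \<open>?d = 0\<close>.\<close>
    let ?q = "(norm h)\<^sup>2 + 1"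
    have q: "?q > 0" by (simp add: add_nonneg_pos)
    have complete_square: "(- d / q)\<^sup>2 * q + 2 * (- d / q) * d = - (d\<^sup>2 / q)" if "q > 0" for d q :: real
      using that by (simp add: field_simps power2_eq_square)
    have "0 \<le> (- ?d / ?q)\<^sup>2 * (norm h)\<^sup>2 + 2 * (- ?d / ?q) * ?d"
      by (rule quad)
    also have "\<dots> \<le> (- ?d / ?q)\<^sup>2 * ?q + 2 * (- ?d / ?q) * ?d"
      by (intro add_right_mono mult_left_mono) auto
    also have "\<dots> = - (?d\<^sup>2 / ?q)"
      using complete_square[OF q] .
    finally have "0 \<le> - (?d\<^sup>2 / ?q)" .
    then have "?d\<^sup>2 / ?q \<le> 0" by (rule neg_0_le_iff_le[THEN iffD1])
    then have "?d = 0"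
      using q unfolding divide_le_0_iff by (metis not_le power2_less_eq_zero_iff)
    then show ?thesis
      using cinner_commute[of h v] by simp
  qed
  \<comment> \<open>The imaginary parts at \<open>x\<close> are, up to sign, the real parts at
    \<open>scaleC \<i> x\<close>.\<close>
  have "\<phi> x = cinner x v" for x
    using Re_eq[of x] Re_eq[of "scaleC \<i> x"]
    by (simp add: scale cinner_scaleC_left complex_eq_iff)
  then show ?thesis by blast
qed

text \<open>Justifies the definite description in \<open>adj\<close>: Riesz representation gives
  existence, and uniqueness holds because inner products determine a vector.\<close>

lemma adj_cinner:
  assumes "bounded_clinear a"
  shows "cinner (a x) y = cinner x (adj a y)"
proof -
  obtain K where lin: "clinear a" and K: "\<And>x. norm (a x) \<le> K * norm x"
    using assms unfolding bounded_clinear_def by blast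
  have "\<exists>u. \<forall>x. cinner (a x) y = cinner x u" for y
  proof (rule Riesz_representation[where K = "K * norm y"])
    show "cmod (cinner (a x) y) \<le> K * norm y * norm x" for x
      using order_trans[OF norm_cinner_le mult_right_mono[OF K norm_ge_zero]]
      by (simp add: ac_simps)
  qed (auto simp: clinear_add[OF lin] clinear_scaleC[OF lin] cinner_add_left cinner_scaleC_left)
  then obtain B where B: "\<forall>x y. cinner (a x) y = cinner x (B y)"
    by metis
  have "\<forall>x y. cinner (a x) y = cinner x (adj a y)"
    unfolding adj_def
  proof (rule theI[of _ B])
    fix C assume "\<forall>x y. cinner (a x) y = cinner x (C y)"
    then show "C = B" using B by (metis cinner_eqI ext)
  qed (rule B)
  then show ?thesis by blast
qed

lemma adj_bounded_linear:
  assumes "bounded_clinear a"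
  shows "bounded_linear (adj a)"
proof -
  obtain K where lin: "clinear a" and K: "\<And>x. norm (a x) \<le> K * norm x"
    using assms unfolding bounded_clinear_def by blast
  note adj = adj_cinner[OF assms]
  show ?thesis
  proof (rule bounded_linear_intro[where K = "K"])
    fix x y and r :: real
    show "adj a (x + y) = adj a x + adj a y"
      by (rule cinner_eqI) (simp add: cinner_add_right flip: adj)
    show "adj a (scaleR r x) = scaleR r (adj a x)"
      by (rule cinner_eqI) (simp add: scaleR_scaleC cinner_scaleC_right flip: adj)
    have "complex_of_real ((norm (adj a x))\<^sup>2) = cinner (a (adj a x)) x"
      by (simp add: adj cinner_self)
    then have "(norm (adj a x))\<^sup>2 = cmod (cinner (a (adj a x)) x)"
      by (metis abs_of_nonneg norm_of_real zero_le_power2)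
    also have "\<dots> \<le> K * norm (adj a x) * norm x"
      using order_trans[OF norm_cinner_le mult_right_mono[OF K norm_ge_zero]] .
    finally have "norm (adj a x) * norm (adj a x) \<le> norm (adj a x) * (norm x * K)"
      by (simp add: power2_eq_square ac_simps)
    \<comment> \<open>Covers the case \<open>adj a x = 0\<close>, in which the common factor cannot
      be cancelled.\<close>
    moreover have "0 \<le> norm x * K"
      using order_trans[OF norm_ge_zero K[of x]] by (simp add: mult.commute)
    ultimately show "norm (adj a x) \<le> norm x * K"
      by (metis mult_le_cancel_left_pos norm_ge_zero order_le_less)
  qed
qed

section \<open>Orthonormal sequences and diagonal operators\<close>

definition orthonormal_set :: "'a::complex_hilbert_space set \<Rightarrow> bool" where
  "orthonormal_set F \<longleftrightarrow> (\<forall>f\<in>F. \<forall>g\<in>F. cinner f g = (if f = g then 1 else 0))"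

definition orthonormal :: "(nat \<Rightarrow> 'a::complex_hilbert_space) \<Rightarrow> bool" where
  "orthonormal e \<longleftrightarrow> (\<forall>i j. cinner (e i) (e j) = (if i = j then 1 else 0))"

lemma orthonormal_cinner: "orthonormal e \<Longrightarrow> cinner (e i) (e j) = (if i = j then 1 else 0)"
  by (simp add: orthonormal_def)

lemma orthonormal_norm: "orthonormal e \<Longrightarrow> norm (e i) = 1"
  using orthonormal_cinner[of e i i] by (simp add: norm_eq_sqrt_cinner)

lemma orthonormal_inj: "orthonormal e \<Longrightarrow> inj e"
  by (metis injI one_neq_zero orthonormal_cinner)

lemma cinner_orthonormal_sum:
  assumes "orthonormal e" "finite I"
  shows "cinner (\<Sum>i\<in>I. scaleC (u i) (e i)) (e j) = (if j \<in> I then u j else 0)"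
  using assms(2)
  by (simp add: cinner_sum_left cinner_scaleC_left orthonormal_cinner[OF assms(1)] sum.delta
      if_distrib[of "\<lambda>x. _ * x"] cong: if_cong)

text \<open>The lengths \<open>r i\<close> may vanish, which admits the images of singular vectors
  as well as orthonormal families.\<close>

lemma norm_orthogonal_sum:
  fixes f :: "nat \<Rightarrow> 'a::complex_hilbert_space"
  assumes "finite I" and orth: "\<And>i j. cinner (f i) (f j) = (if i = j then of_real ((r i)\<^sup>2) else 0)"
  shows "(norm (\<Sum>i\<in>I. scaleC (u i) (f i)))\<^sup>2 = (\<Sum>i\<in>I. (r i)\<^sup>2 * (cmod (u i))\<^sup>2)"
proof -
  have "complex_of_real ((norm (\<Sum>i\<in>I. scaleC (u i) (f i)))\<^sup>2)
      = (\<Sum>i\<in>I. \<Sum>j\<in>I. cnj (u i) * (u j * cinner (f j) (f i)))"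
    unfolding cinner_self[symmetric]
    by (simp add: cinner_sum_left cinner_sum_right cinner_scaleC_left cinner_scaleC_right
        sum_distrib_left)
  also have "\<dots> = (\<Sum>i\<in>I. complex_of_real ((r i)\<^sup>2 * (cmod (u i))\<^sup>2))"
    using assms(1)
    by (intro sum.cong) (simp_all add: orth if_distrib[of "\<lambda>x. _ * x"] sum.delta mult_cnj_eq
        power2_eq_square[of "complex_of_real (cmod _)"] ac_simps cong: if_cong)
  also have "\<dots> = complex_of_real (\<Sum>i\<in>I. (r i)\<^sup>2 * (cmod (u i))\<^sup>2)"
    by (rule of_real_sum[symmetric])
  finally show ?thesis
    by (rule of_real_eq_iff[THEN iffD1])
qed

lemma norm_orthonormal_sum:
  assumes "orthonormal e" "finite I"
  shows "(norm (\<Sum>i\<in>I. scaleC (u i) (e i)))\<^sup>2 = (\<Sum>i\<in>I. (cmod (u i))\<^sup>2)"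
  using norm_orthogonal_sum[of I e "\<lambda>_. 1" u] assms orthonormal_cinner[of e] by simp

text \<open>Pythagoras for the orthogonal projection onto the span of finitely many
  \<open>e i\<close>. Dropping either summand on the left gives Bessel's inequality or the
  contractivity of the complementary projection.\<close>

lemma norm_minus_orthonormal_sum:
  assumes "orthonormal e" "finite I"
  shows "(norm (x - (\<Sum>i\<in>I. scaleC (cinner x (e i)) (e i))))\<^sup>2 + (\<Sum>i\<in>I. (cmod (cinner x (e i)))\<^sup>2)
    = (norm x)\<^sup>2"
proof -
  let ?P = "\<Sum>i\<in>I. scaleC (cinner x (e i)) (e i)"
  have "cinner (x - ?P) ?P = 0"
    by (simp add: cinner_sum_right cinner_scaleC_right cinner_diff_left
        cinner_orthonormal_sum[OF assms])
  then show ?thesis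
    using power2_norm_add[of "x - ?P" ?P] norm_orthonormal_sum[OF assms, of "\<lambda>i. cinner x (e i)"]
    by simp
qed

lemma Bessel_inequality:
  assumes "orthonormal e" "finite I"
  shows "(\<Sum>i\<in>I. (cmod (cinner x (e i)))\<^sup>2) \<le> (norm x)\<^sup>2"
  using norm_minus_orthonormal_sum[OF assms, of x] by (smt (verit) zero_le_power2)

lemma norm_minus_orthonormal_sum_le:
  assumes "orthonormal e" "finite I"
  shows "norm (x - (\<Sum>i\<in>I. scaleC (cinner x (e i)) (e i))) \<le> norm x"
proof (rule power2_le_imp_le)
  have "0 \<le> (\<Sum>i\<in>I. (cmod (cinner x (e i)))\<^sup>2)" by (simp add: sum_nonneg)
  then show "(norm (x - (\<Sum>i\<in>I. scaleC (cinner x (e i)) (e i))))\<^sup>2 \<le> (norm x)\<^sup>2"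
    using norm_minus_orthonormal_sum[OF assms, of x] by linarith
qed simp

lemma orthonormal_independent:
  assumes "orthonormal e"
  shows "complex_vector.independent (e ` I)"
proof -
  have "\<not> complex_vector.dependent (e ` I)"
    unfolding complex_vector.dependent_explicit
  proof clarify
    fix t u v assume t: "finite t" "t \<subseteq> e ` I" and sum: "(\<Sum>v\<in>t. scaleC (u v) v) = 0"
      and v: "v \<in> t" "u v \<noteq> 0"
    have "0 = cinner (\<Sum>v\<in>t. scaleC (u v) v) v" by (simp add: sum)
    also have "\<dots> = (\<Sum>w\<in>t. if w = v then u w else 0)"
      unfolding cinner_sum_left
    proof (rule sum.cong)
      fix w assume "w \<in> t"
      then obtain i j where "w = e i" "v = e j" using t v by blast
      then show "cinner (scaleC (u w) w) v = (if w = v then u w else 0)"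
        using orthonormal_cinner[OF assms, of i j] orthonormal_inj[OF assms]
        by (auto simp: cinner_scaleC_left dest: injD)
    qed simp
    also have "\<dots> = u v" using t v by simp
    finally show False using v by simp
  qed
  then show ?thesis .
qed

section \<open>Diagonal operators with entries decreasing to zero\<close>

text \<open>A junk value unless the series converges, as it does for orthonormal \<open>e\<close> and bounded \<open>s\<close>.\<close>

definition diagonal_operator ::
    "(nat \<Rightarrow> 'a::complex_hilbert_space) \<Rightarrow> (nat \<Rightarrow> real) \<Rightarrow> 'a \<Rightarrow> 'a" where
  "diagonal_operator e s x = (\<Sum>i. scaleC (of_real (s i) * cinner x (e i)) (e i))"

text \<open>Modelled on the singular vectors and values of a compact operator, whose absolute value
  \<open>D\<close> will turn out to be. The family \<open>e\<close> may span a proper subspace;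
  \<open>D\<close> is zero on the orthogonal complement.\<close>

locale null_diagonal =
  fixes e :: "nat \<Rightarrow> 'a::complex_hilbert_space" and s :: "nat \<Rightarrow> real"
  assumes orthonormal: "orthonormal e"
    and decseq: "decseq s"
    and nonneg: "\<And>i. 0 \<le> s i"
    and null: "s \<longlonglongrightarrow> 0"
begin

abbreviation D where "D \<equiv> diagonal_operator e s"

text \<open>A consequence of Bessel's inequality with two uses: for growing \<open>m\<close> it is
  the Cauchy criterion for the series, and for \<open>m = 0\<close> it bounds the operator
  norm.\<close>

lemma partial_sum_le:
  assumes "finite I" "\<And>i. i \<in> I \<Longrightarrow> m \<le> i"
  shows "norm (\<Sum>i\<in>I. scaleC (of_real (s i) * cinner x (e i)) (e i)) \<le> s m * norm x"
proof (rule power2_le_imp_le)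
  have "(norm (\<Sum>i\<in>I. scaleC (of_real (s i) * cinner x (e i)) (e i)))\<^sup>2
      = (\<Sum>i\<in>I. (s i)\<^sup>2 * (cmod (cinner x (e i)))\<^sup>2)"
    by (simp add: norm_orthonormal_sum[OF orthonormal assms(1)] norm_mult power_mult_distrib)
  also have "\<dots> \<le> (\<Sum>i\<in>I. (s m)\<^sup>2 * (cmod (cinner x (e i)))\<^sup>2)"
    using assms(2) decseq nonneg
    by (intro sum_mono mult_right_mono power_mono) (auto dest: decseqD)
  also have "\<dots> \<le> (s m)\<^sup>2 * (norm x)\<^sup>2"
    unfolding sum_distrib_left[symmetric]
    by (intro mult_left_mono Bessel_inequality[OF orthonormal assms(1)]) auto
  finally show "(norm (\<Sum>i\<in>I. scaleC (of_real (s i) * cinner x (e i)) (e i)))\<^sup>2 \<le> (s m * norm x)\<^sup>2"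
    by (simp add: power_mult_distrib)
qed (simp add: nonneg)

lemma sums_D: "(\<lambda>i. scaleC (of_real (s i) * cinner x (e i)) (e i)) sums D x"
proof -
  have "summable (\<lambda>i. scaleC (of_real (s i) * cinner x (e i)) (e i))"
  proof (rule summable_Cauchy')
    show "(\<lambda>m. s m * norm x) \<longlonglongrightarrow> 0"
      using tendsto_mult_right[OF null, of "norm x"] by simp
  qed (auto intro!: always_eventually partial_sum_le)
  then show ?thesis
    unfolding diagonal_operator_def by (rule summable_sums)
qed

lemma cinner_D: "cinner (D x) (e j) = of_real (s j) * cinner x (e j)"
proof -
  have "(\<lambda>i. cinner (scaleC (of_real (s i) * cinner x (e i)) (e i)) (e j)) sums cinner (D x) (e j)"
    by (rule bounded_linear.sums[OF bounded_linear_cinner_left sums_D])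
  moreover have "(\<lambda>i. cinner (scaleC (of_real (s i) * cinner x (e i)) (e i)) (e j))
      = (\<lambda>i. if i = j then of_real (s i) * cinner x (e i) else 0)"
    by (auto simp: cinner_scaleC_left orthonormal_cinner[OF orthonormal])
  ultimately have "(\<lambda>i. if i = j then of_real (s i) * cinner x (e i) else 0) sums cinner (D x) (e j)"
    by simp
  then show ?thesis
    by (rule sums_unique2) (rule sums_single)
qed

lemma D_basis: "D (e j) = scaleC (of_real (s j)) (e j)"
proof -
  have "(\<lambda>i. scaleC (of_real (s i) * cinner (e j) (e i)) (e i))
      = (\<lambda>i. if i = j then scaleC (of_real (s i)) (e i) else 0)"
    by (auto simp: orthonormal_cinner[OF orthonormal])
  then have "(\<lambda>i. scaleC (of_real (s i) * cinner (e j) (e i)) (e i)) sums scaleC (of_real (s j)) (e j)"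
    using sums_single[of j "\<lambda>i. scaleC (of_real (s i)) (e i)"] by simp
  then show ?thesis
    by (rule sums_unique2[OF sums_D])
qed

lemma sums_D_D: "(\<lambda>i. scaleC (of_real ((s i)\<^sup>2) * cinner x (e i)) (e i)) sums D (D x)"
  using sums_D[of "D x"] by (simp add: cinner_D power2_eq_square mult.assoc)

lemma norm_D_le: "norm (D x) \<le> s 0 * norm x"
proof -
  have "(\<lambda>n. norm (\<Sum>i<n. scaleC (of_real (s i) * cinner x (e i)) (e i))) \<longlonglongrightarrow> norm (D x)"
    using sums_D[of x] unfolding sums_def by (rule tendsto_norm)
  then show ?thesis
    by (rule LIMSEQ_le_const2) (auto intro!: partial_sum_le)
qed

lemma clinear_D: "clinear D"
  unfolding clinear_iff
proof safe
  fix x y c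
  have "(\<lambda>i. scaleC (of_real (s i) * cinner (x + y) (e i)) (e i)) sums (D x + D y)"
    using sums_add[OF sums_D[of x] sums_D[of y]]
    by (simp add: cinner_add_left distrib_left scaleC_add_left)
  then show "D (x + y) = D x + D y"
    by (rule sums_unique2[OF sums_D])
  have "(\<lambda>i. scaleC (of_real (s i) * cinner (scaleC c x) (e i)) (e i)) sums scaleC c (D x)"
    using bounded_linear.sums[OF bounded_linear_scaleC_right[of c] sums_D[of x]]
    by (simp add: cinner_scaleC_left scaleC_scaleC ac_simps)
  then show "D (scaleC c x) = scaleC c (D x)"
    by (rule sums_unique2[OF sums_D])
qed

lemma positive_D: "positive_operator D"
  unfolding positive_operator_def bounded_clinear_def
proof (intro conjI allI)
  show "clinear D" by (rule clinear_D)
  show "\<exists>K. \<forall>x. norm (D x) \<le> K * norm x" using norm_D_le by blast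
  fix x
  have eq: "cinner (scaleC (of_real (s i) * cinner x (e i)) (e i)) x
      = of_real (s i * (cmod (cinner x (e i)))\<^sup>2)" for i
    using cinner_commute[of "e i" x]
    by (simp add: cinner_scaleC_left mult_cnj_eq mult.commute[of "cnj _"])
  have sums: "(\<lambda>i. of_real (s i * (cmod (cinner x (e i)))\<^sup>2)) sums cinner (D x) x"
    using bounded_linear.sums[OF bounded_linear_cinner_left[of x] sums_D[of x]] unfolding eq .
  have "(\<lambda>i. 0) sums Im (cinner (D x) x)"
    using sums_Im[OF sums] by simp
  then have "Im (cinner (D x) x) = 0"
    by (rule sums_unique2) (rule sums_zero)
  then show "cinner (D x) x \<in> \<real>"
    by (simp add: complex_is_Real_iff)
  have "(\<lambda>i. s i * (cmod (cinner x (e i)))\<^sup>2) sums Re (cinner (D x) x)"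
    using sums_Re[OF sums] by simp
  then show "0 \<le> Re (cinner (D x) x)"
    by (rule sums_le[OF _ sums_zero, rotated]) (simp add: nonneg)
qed

lemma finite_level: "t > 0 \<Longrightarrow> finite {i. s i = t}"
proof -
  assume "t > 0"
  then have "eventually (\<lambda>i. s i < t) sequentially"
    using null order_tendstoD(2) by blast
  then obtain N where "\<And>i. i \<ge> N \<Longrightarrow> s i < t"
    unfolding eventually_sequentially by blast
  then have "{i. s i = t} \<subseteq> {..<N}"
    by (metis (mono_tags, lifting) lessThan_iff less_irrefl linorder_not_less mem_Collect_eq subsetI)
  then show ?thesis using finite_subset by blast
qed

text \<open>If \<open>D x = t x\<close>, comparing coefficients against \<open>e i\<close> leaves
  only the indices with \<open>s i = t\<close>. So \<open>D x\<close> is a finite combination of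
  these \<open>e i\<close>, and dividing by \<open>t > 0\<close> gives the same for
  \<open>x\<close>, even if \<open>e\<close> is incomplete.\<close>

lemma eigenspace_D:
  assumes "t > 0"
  shows "eigenspace D (of_real t) = cspan (e ` {i. s i = t})"
proof
  let ?I = "{i. s i = t}"
  show "cspan (e ` ?I) \<subseteq> eigenspace D (of_real t)"
  proof (rule complex_vector.span_minimal)
    show "e ` ?I \<subseteq> eigenspace D (of_real t)"
      by (auto simp: eigenspace_def D_basis)
    show "complex_vector.subspace (eigenspace D (of_real t))"
      unfolding complex_vector.subspace_def eigenspace_def
      by (auto simp: clinear_add[OF clinear_D] clinear_scaleC[OF clinear_D] clinear_zero[OF clinear_D]
          scaleC_add_right scaleC_scaleC mult.commute)
  qed
  show "eigenspace D (of_real t) \<subseteq> cspan (e ` ?I)"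
  proof
    fix x assume "x \<in> eigenspace D (of_real t)"
    then have x: "D x = scaleC (of_real t) x" by (simp add: eigenspace_def)
    have term_eq: "scaleC (of_real (s i) * cinner x (e i)) (e i)
        = (if i \<in> ?I then scaleC (of_real t * cinner x (e i)) (e i) else 0)" for i
    proof -
      have "of_real t * cinner x (e i) = of_real (s i) * cinner x (e i)"
        using cinner_D[of x i] by (simp add: x cinner_scaleC_left)
      then show ?thesis by auto
    qed
    have "(\<lambda>i. if i \<in> ?I then scaleC (of_real t * cinner x (e i)) (e i) else 0) sums
        (\<Sum>i\<in>?I. scaleC (of_real t * cinner x (e i)) (e i))"
      by (rule sums_If_finite_set[OF finite_level[OF assms]])
    then have "D x = (\<Sum>i\<in>?I. scaleC (of_real t * cinner x (e i)) (e i))"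
      using sums_D[of x] unfolding term_eq by (rule sums_unique2[rotated])
    also have "\<dots> \<in> cspan (e ` ?I)"
      by (intro complex_vector.span_sum complex_vector.span_scale complex_vector.span_base) auto
    finally have "scaleC (inverse (of_real t)) (D x) \<in> cspan (e ` ?I)"
      by (rule complex_vector.span_scale)
    then show "x \<in> cspan (e ` ?I)"
      using assms by (simp add: x scaleC_scaleC)
  qed
qed

lemma is_eigenvalue_sequence_D: "is_eigenvalue_sequence D s"
proof -
  have "cdim (eigenspace D (of_real t)) = card {i. s i = t}" if "t > 0" for t
    using complex_vector.dim_span_eq_card_independent[OF orthonormal_independent[OF orthonormal]]
      card_image[OF inj_on_subset[OF orthonormal_inj[OF orthonormal] subset_UNIV]]
    by (metis eigenspace_D[OF that])
  then show ?thesis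
    unfolding is_eigenvalue_sequence_def using decseq nonneg finite_level by auto
qed

end

text \<open>At the first index where the sequences differ, the larger of the two values would occur
  with different multiplicities.\<close>

lemma eigenvalue_sequence_unique:
  assumes "is_eigenvalue_sequence a \<mu>" "is_eigenvalue_sequence a \<nu>"
  shows "\<mu> = \<nu>"
proof (rule ccontr)
  have no_gap: False
    if "is_eigenvalue_sequence a \<mu>" "is_eigenvalue_sequence a \<nu>"
      and lt: "\<nu> i < \<mu> i" and eq: "\<And>j. j < i \<Longrightarrow> \<mu> j = \<nu> j" for \<mu> \<nu> i
  proof -
    let ?t = "\<mu> i"
    have "0 \<le> \<nu> i" "decseq \<nu>" using that(2) by (auto simp: is_eigenvalue_sequence_def)
    then have t: "?t > 0" using lt by simp
    have fin: "finite {j. \<mu> j = ?t}" and card: "card {j. \<mu> j = ?t} = card {j. \<nu> j = ?t}"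
      using that(1,2) t by (auto simp: is_eigenvalue_sequence_def)
    have "j < i" if "\<nu> j = ?t" for j
      using decseqD[OF \<open>decseq \<nu>\<close>, of i j] that lt by (intro not_le_imp_less notI) simp
    \<comment> \<open>\<open>\<nu>\<close> takes the value \<open>?t\<close> only before
      \<open>i\<close>, where the sequences agree; \<open>\<mu>\<close> takes it there and also at
      \<open>i\<close>.\<close>
    then have "{j. \<nu> j = ?t} \<subset> {j. \<mu> j = ?t}"
      using eq lt by (auto simp: psubset_eq)
    then show False
      using psubset_card_mono[OF fin] card by (metis less_irrefl)
  qed
  assume "\<mu> \<noteq> \<nu>"
  then have "\<exists>i. \<mu> i \<noteq> \<nu> i" by auto
  then obtain i where i: "\<mu> i \<noteq> \<nu> i" "\<And>j. j < i \<Longrightarrow> \<mu> j = \<nu> j"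
    using exists_least_iff[of "\<lambda>i. \<mu> i \<noteq> \<nu> i"] by auto
  then show False
    using no_gap[OF assms, of i] no_gap[OF assms(2,1), of i] by fastforce
qed

lemma eigenvalue_eq:
  assumes "is_eigenvalue_sequence a \<mu>"
  shows "eigenvalue a i = \<mu> (i - 1)"
  unfolding eigenvalue_def
  using the_equality[of "is_eigenvalue_sequence a" \<mu>] assms eigenvalue_sequence_unique by metis

section \<open>Singular values of compact operators\<close>

lemma bounded_clinear_imp_bounded_linear:
  assumes "bounded_clinear a"
  shows "bounded_linear a"
proof -
  obtain K where lin: "clinear a" and K: "\<And>x. norm (a x) \<le> K * norm x"
    using assms unfolding bounded_clinear_def by blast
  show ?thesis
    by (rule bounded_linear_intro[where K = K])
       (simp_all add: clinear_add[OF lin] clinear_scaleC[OF lin] scaleR_scaleC K mult.commute[of _ K])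
qed

lemma compact_operator_bounded:
  assumes "a \<in> compact_operators"
  shows "bounded_clinear a"
proof -
  have lin: "clinear a" and "compact (closure (a ` cball 0 1))"
    using assms by (auto simp: compact_operators_def)
  then have "bounded (closure (a ` cball 0 1))"
    by (intro compact_imp_bounded)
  then have "bounded (a ` cball 0 1)"
    by (rule bounded_subset) (rule closure_subset)
  then obtain K where K: "\<And>x. norm x \<le> 1 \<Longrightarrow> norm (a x) \<le> K"
    unfolding bounded_iff by (metis image_eqI mem_cball_0)
  have "norm (a x) \<le> K * norm x" for x
  proof (cases "x = 0")
    case False
    have "norm (a (scaleR (1 / norm x) x)) \<le> K"
      using False by (intro K) simp
    moreover have "norm (a (scaleR (1 / norm x) x)) = norm (a x) / norm x"
      unfolding scaleR_scaleC clinear_scaleC[OF lin] norm_scaleC by (simp add: norm_divide)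
    ultimately show ?thesis
      using False by (simp add: divide_le_eq)
  qed (simp add: clinear_zero[OF lin])
  then show ?thesis
    using lin by (auto simp: bounded_clinear_def)
qed

lemma compact_operator_subseq:
  assumes "a \<in> compact_operators" "\<And>n. norm (x n) \<le> 1"
  obtains l and r :: "nat \<Rightarrow> nat" where "strict_mono r" "(\<lambda>n. a (x (r n))) \<longlonglongrightarrow> l"
proof -
  have "seq_compact (closure (a ` cball 0 1))"
    using assms(1) by (auto simp: compact_operators_def compact_eq_seq_compact_metric)
  moreover have "\<forall>n. a (x n) \<in> closure (a ` cball 0 1)"
    using assms(2) closure_subset by fastforce
  ultimately obtain l and r :: "nat \<Rightarrow> nat" where "strict_mono r" "((\<lambda>n. a (x n)) \<circ> r) \<longlonglongrightarrow> l"
    by (rule seq_compactE)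
  then show ?thesis
    using that by (simp add: o_def)
qed

text \<open>The image of the unit ball lies in the sum of two compact sets, which is again
  compact.\<close>

lemma compact_operator_add:
  assumes "a \<in> compact_operators" "b \<in> compact_operators"
  shows "(\<lambda>x. a x + b x) \<in> compact_operators"
proof -
  let ?A = "closure (a ` cball 0 1)" and ?B = "closure (b ` cball 0 1)"
  have lin: "clinear a" "clinear b" and cpt: "compact ?A" "compact ?B"
    using assms by (auto simp: compact_operators_def)
  have "compact {x + y |x y. x \<in> ?A \<and> y \<in> ?B}"
    using cpt by (rule compact_sums)
  moreover have "(\<lambda>x. a x + b x) ` cball 0 1 \<subseteq> {x + y |x y. x \<in> ?A \<and> y \<in> ?B}"
    using closure_subset[of "a ` cball 0 1"] closure_subset[of "b ` cball 0 1"] by blast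
  ultimately have "closure ((\<lambda>x. a x + b x) ` cball 0 1) \<subseteq> {x + y |x y. x \<in> ?A \<and> y \<in> ?B}"
    by (intro closure_minimal compact_imp_closed)
  then have "compact (closure ((\<lambda>x. a x + b x) ` cball 0 1))"
    using compact_Int_closed[OF \<open>compact {x + y |x y. x \<in> ?A \<and> y \<in> ?B}\<close>,
        of "closure ((\<lambda>x. a x + b x) ` cball 0 1)"]
    by (simp only: closed_closure inf.absorb2)
  then show ?thesis
    using lin by (auto simp: compact_operators_def clinear_iff scaleC_add_right)
qed

lemma cinner_adj_comp:
  assumes "bounded_clinear a"
  shows "cinner (adj a (a x)) y = cinner (a x) (a y)"
    and "cinner x (adj a (a y)) = cinner (a x) (a y)"
  using adj_cinner[OF assms] cinner_commute by metis+

section \<open>Variational construction of singular vectors\<close>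

text \<open>A vector on which \<open>a\<close> attains its norm on the orthogonal complement of \<open>F\<close> is a limit of a
  maximising sequence, because \<open>\<parallel>a\<^sup>*a x - M\<^sup>2 x\<parallel>\<^sup>2 \<le> M\<^sup>4 - M\<^sup>2 \<parallel>a x\<parallel>\<^sup>2\<close> there.\<close>

lemma maximal_vector_exists:
  fixes a :: "'a::complex_hilbert_space \<Rightarrow> 'a"
  assumes a: "a \<in> compact_operators"
    and z: "z \<noteq> 0" "\<And>f. f \<in> F \<Longrightarrow> cinner z f = 0"
    and eig: "\<And>f. f \<in> F \<Longrightarrow> \<exists>l. adj a (a f) = scaleC l f"
  shows "\<exists>e. norm e = 1 \<and> (\<forall>f\<in>F. cinner e f = 0) \<and>
    adj a (a e) = scaleC (of_real ((norm (a e))\<^sup>2)) e \<and>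
    (\<forall>x. (\<forall>f\<in>F. cinner x f = 0) \<longrightarrow> norm (a x) \<le> norm (a e) * norm x)"
proof -
  have bdd: "bounded_clinear a" by (rule compact_operator_bounded[OF a])
  then obtain K where lin: "clinear a" and K: "\<And>x. norm (a x) \<le> K * norm x"
    unfolding bounded_clinear_def by blast
  note cont = bounded_clinear_imp_bounded_linear[OF bdd] adj_bounded_linear[OF bdd]
  \<comment> \<open>\<open>S\<close> is the orthogonal complement of \<open>F\<close>, and
    \<open>M\<close> the norm of \<open>a\<close> restricted to it.\<close>
  define S where "S = {x. \<forall>f\<in>F. cinner x f = 0}"
  define V where "V = (\<lambda>x. norm (a x)) ` {x\<in>S. norm x \<le> 1}"
  define M where "M = Sup V"
  have "norm (a x) \<le> \<bar>K\<bar>" if "norm x \<le> 1" for x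
    using K[of x] that mult_mono[OF abs_ge_self[of K] that] by simp
  then have bdd_V: "bdd_above V"
    unfolding V_def by (intro bdd_aboveI2[where M = "\<bar>K\<bar>"]) simp
  have S_scaleR: "scaleR r x \<in> S" if "x \<in> S" for r x
    using that by (auto simp: S_def scaleR_scaleC cinner_scaleC_left)
  have M_unit: "norm (a x) \<le> M" if "x \<in> S" "norm x \<le> 1" for x
    unfolding M_def using bdd_V that by (intro cSup_upper) (auto simp: V_def)
  have M: "norm (a x) \<le> M * norm x" if "x \<in> S" for x
  proof (cases "x = 0")
    case False
    have "norm (a (scaleR (1 / norm x) x)) \<le> M"
      using False by (intro M_unit S_scaleR that) simp
    then show ?thesis
      using False by (simp add: linear_simps(5)[OF cont(1)] divide_simps)
  qed (simp add: clinear_zero[OF lin])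
  have zero: "0 \<in> S" by (simp add: S_def)
  then have M_nonneg: "0 \<le> M"
    using M_unit[of 0] by (simp add: clinear_zero[OF lin])
  show ?thesis
  proof (cases "M = 0")
    \<comment> \<open>Here \<open>a\<close> vanishes on \<open>S\<close>, so the normalised
      \<open>z\<close> has all required properties.\<close>
    case True
    let ?e = "scaleR (1 / norm z) z"
    have "z \<in> S" using z by (simp add: S_def)
    then have e: "?e \<in> S" "norm ?e = 1"
      using z(1) S_scaleR by auto
    have null: "a x = 0" if "x \<in> S" for x
      using M[OF that] True by simp
    show ?thesis
      using e null[OF e(1)] null
      by (intro exI[of _ ?e]) (auto simp: S_def linear_simps(3)[OF cont(2)])
  next
    case False
    then have M_pos: "M > 0" using M_nonneg by simp
    have defect: "(norm (adj a (a x) - scaleR (M\<^sup>2) x))\<^sup>2 \<le> M\<^sup>2 * (M\<^sup>2 - (norm (a x))\<^sup>2)"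
      if x: "x \<in> S" "norm x \<le> 1" for x
    proof -
      let ?T = "adj a (a x)"
      \<comment> \<open>\<open>F\<close> consists of eigenvectors of the selfadjoint
        \<open>a\<^sup>*a\<close>, which therefore preserves \<open>S\<close>; hence the bound
        \<open>M\<close> also applies to \<open>?T\<close>.\<close>
      have "cinner ?T f = 0" if "f \<in> F" for f
      proof -
        obtain l where "adj a (a f) = scaleC l f" using eig[OF \<open>f \<in> F\<close>] by blast
        moreover have "cinner ?T f = cinner x (adj a (a f))"
          by (simp add: cinner_adj_comp[OF bdd])
        ultimately show ?thesis
          using x(1) \<open>f \<in> F\<close> by (simp add: cinner_scaleC_right S_def)
      qed
      then have T: "?T \<in> S" by (simp add: S_def)
      have "complex_of_real ((norm ?T)\<^sup>2) = cinner (a x) (a ?T)"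
        by (simp only: cinner_self[symmetric] cinner_adj_comp(1)[OF bdd])
      then have "(norm ?T)\<^sup>2 = cmod (cinner (a x) (a ?T))"
        by (metis abs_of_nonneg norm_of_real zero_le_power2)
      also have "\<dots> \<le> norm (a x) * (M * norm ?T)"
        by (rule order_trans[OF norm_cinner_le mult_left_mono[OF M[OF T] norm_ge_zero]])
      finally have "norm ?T * norm ?T \<le> norm ?T * (M * norm (a x))"
        by (simp add: power2_eq_square ac_simps)
      moreover have "0 \<le> M * norm (a x)" using M_nonneg by simp
      ultimately have "norm ?T \<le> M * norm (a x)"
        by (metis mult_le_cancel_left_pos norm_ge_zero order_le_less)
      then have T_le: "(norm ?T)\<^sup>2 \<le> M\<^sup>2 * (norm (a x))\<^sup>2"
        using power_mono[of "norm ?T" "M * norm (a x)" 2] by (simp add: power_mult_distrib)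
      have "(norm x)\<^sup>2 \<le> 1"
        using x(2) by (simp add: power_le_one)
      then have "M\<^sup>2 * M\<^sup>2 * (norm x)\<^sup>2 \<le> M\<^sup>2 * M\<^sup>2 * 1"
        by (intro mult_left_mono) auto
      then have x_le: "(norm (scaleR (M\<^sup>2) x))\<^sup>2 \<le> M\<^sup>2 * M\<^sup>2"
        by (simp add: power2_eq_square ac_simps)
      have "cinner ?T (scaleR (M\<^sup>2) x) = of_real (M\<^sup>2 * (norm (a x))\<^sup>2)"
        by (simp add: scaleR_scaleC cinner_scaleC_right cinner_adj_comp[OF bdd] cinner_self)
      then have "Re (cinner ?T (scaleR (M\<^sup>2) x)) = M\<^sup>2 * (norm (a x))\<^sup>2"
        by (metis Re_complex_of_real)
      then have "(norm (?T - scaleR (M\<^sup>2) x))\<^sup>2 \<le> M\<^sup>2 * M\<^sup>2 - M\<^sup>2 * (norm (a x))\<^sup>2"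
        unfolding power2_norm_diff using T_le x_le by linarith
      then show ?thesis
        by (simp add: right_diff_distrib)
    qed
    have "\<exists>x. x \<in> S \<and> norm x \<le> 1 \<and> M - 1 / Suc n < norm (a x)" for n
    proof -
      have "V \<noteq> {}" using zero by (force simp: V_def)
      then have "\<exists>v\<in>V. M - 1 / Suc n < v"
        using less_cSup_iff[OF _ bdd_V, of "M - 1 / Suc n"] by (simp add: M_def)
      then show ?thesis by (auto simp: V_def)
    qed
    then obtain x where x: "\<And>n. x n \<in> S" "\<And>n. norm (x n) \<le> 1" "\<And>n. M - 1 / Suc n < norm (a (x n))"
      by metis
    have lim_M: "(\<lambda>n. norm (a (x n))) \<longlonglongrightarrow> M"
    proof (rule tendsto_sandwich)
      show "(\<lambda>n. M - 1 / Suc n) \<longlonglongrightarrow> M"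
        using tendsto_diff[OF tendsto_const LIMSEQ_Suc[OF lim_1_over_n]] by simp
      show "(\<lambda>n. M) \<longlonglongrightarrow> M" by simp
      show "\<forall>\<^sub>F n in sequentially. M - 1 / Suc n \<le> norm (a (x n))"
        using x(3) by (intro always_eventually allI less_imp_le)
      show "\<forall>\<^sub>F n in sequentially. norm (a (x n)) \<le> M"
        using M_unit[OF x(1) x(2)] by (intro always_eventually allI)
    qed
    obtain y and r :: "nat \<Rightarrow> nat" where r: "strict_mono r" and y: "(\<lambda>n. a (x (r n))) \<longlonglongrightarrow> y"
      by (rule compact_operator_subseq[OF a x(2)])
    let ?w = "adj a y"
    let ?e = "scaleR (1 / M\<^sup>2) ?w"
    have lim_r: "(\<lambda>n. norm (a (x (r n)))) \<longlonglongrightarrow> M"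
      using LIMSEQ_subseq_LIMSEQ[OF lim_M r] by (simp add: o_def)
    have "(\<lambda>n. M\<^sup>2 * (M\<^sup>2 - (norm (a (x (r n))))\<^sup>2)) \<longlonglongrightarrow> M\<^sup>2 * (M\<^sup>2 - M\<^sup>2)"
      by (intro tendsto_intros lim_r)
    then have "(\<lambda>n. M\<^sup>2 * (M\<^sup>2 - (norm (a (x (r n))))\<^sup>2)) \<longlonglongrightarrow> 0"
      by simp
    then have "(\<lambda>n. (norm (adj a (a (x (r n))) - scaleR (M\<^sup>2) (x (r n))))\<^sup>2) \<longlonglongrightarrow> 0"
      by (rule tendsto_sandwich[OF _ _ tendsto_const[of 0], rotated 2])
         (simp_all add: always_eventually defect[OF x(1) x(2)])
    then have "(\<lambda>n. sqrt ((norm (adj a (a (x (r n))) - scaleR (M\<^sup>2) (x (r n))))\<^sup>2)) \<longlonglongrightarrow> sqrt 0"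
      by (rule tendsto_real_sqrt)
    then have diff0: "(\<lambda>n. adj a (a (x (r n))) - scaleR (M\<^sup>2) (x (r n))) \<longlonglongrightarrow> 0"
      by (simp add: tendsto_norm_zero_iff)
    have T_lim: "(\<lambda>n. adj a (a (x (r n)))) \<longlonglongrightarrow> ?w"
      by (rule bounded_linear.tendsto[OF cont(2) y])
    \<comment> \<open>Compactness makes only the images converge. The vectors \<open>x (r n)\<close>
      are recovered from \<open>T_lim\<close> and the vanishing defect on dividing by
      \<open>M\<^sup>2 > 0\<close>.\<close>
    have "(\<lambda>n. scaleR (1 / M\<^sup>2) (adj a (a (x (r n))) - (adj a (a (x (r n))) - scaleR (M\<^sup>2) (x (r n)))))
        \<longlonglongrightarrow> scaleR (1 / M\<^sup>2) (?w - 0)"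
      by (intro tendsto_intros T_lim diff0)
    then have e: "(\<lambda>n. x (r n)) \<longlonglongrightarrow> ?e"
      using M_pos by simp
    have "a ?e = y"
      by (rule LIMSEQ_unique[OF bounded_linear.tendsto[OF cont(1) e] y])
    have "norm y = M"
      by (rule LIMSEQ_unique[OF tendsto_norm[OF y] lim_r])
    then have norm_ae: "norm (a ?e) = M" by (simp add: \<open>a ?e = y\<close>)
    have e_S: "?e \<in> S"
      unfolding S_def
    proof safe
      fix f assume "f \<in> F"
      then have "(\<lambda>n. cinner (x (r n)) f) = (\<lambda>n. 0)"
        using x(1) by (auto simp: S_def)
      then show "cinner ?e f = 0"
        using bounded_linear.tendsto[OF bounded_linear_cinner_left[of f] e]
        by (simp add: LIMSEQ_const_iff)
    qed
    have "norm ?e \<le> 1"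
      using tendsto_norm[OF e] x(2) by (intro LIMSEQ_le_const2) auto
    \<comment> \<open>No length is lost in the limit, since \<open>M = \<parallel>a ?e\<parallel>
      \<le> M * \<parallel>?e\<parallel>\<close>.\<close>
    moreover have "1 \<le> norm ?e"
    proof (rule mult_left_le_imp_le[OF _ M_pos])
      show "M * 1 \<le> M * norm ?e"
        using M[OF e_S] unfolding norm_ae by (simp only: mult_1_right)
    qed
    ultimately have "norm ?e = 1" by linarith
    moreover have "adj a (a ?e) = scaleC (of_real ((norm (a ?e))\<^sup>2)) ?e"
      unfolding norm_ae unfolding \<open>a ?e = y\<close> scaleR_scaleC[symmetric] using M_pos by simp
    moreover have "norm (a x) \<le> norm (a ?e) * norm x" if "x \<in> S" for x
      using M[OF that] by (simp only: norm_ae)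
    ultimately show ?thesis
      using e_S unfolding S_def by blast
  qed
qed

text \<open>Infinite dimension provides a vector outside the span of \<open>F\<close>; subtract its
  projection onto that span.\<close>

lemma orthogonal_vector_exists:
  fixes F :: "'a::complex_hilbert_space set"
  assumes inf: "\<not> (\<exists>B::'a set. finite B \<and> cspan B = UNIV)"
    and "finite F" "orthonormal_set F"
  shows "\<exists>z. z \<noteq> 0 \<and> (\<forall>f\<in>F. cinner z f = 0)"
proof -
  obtain x where x: "x \<notin> cspan F"
    using inf \<open>finite F\<close> by blast
  let ?P = "\<Sum>g\<in>F. scaleC (cinner x g) g"
  have "?P \<in> cspan F"
    by (intro complex_vector.span_sum complex_vector.span_scale complex_vector.span_base)
  then have "x - ?P \<noteq> 0" using x by auto
  moreover have "cinner (x - ?P) f = 0" if "f \<in> F" for f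
  proof -
    have "cinner ?P f = (\<Sum>g\<in>F. if g = f then cinner x g else 0)"
      unfolding cinner_sum_left
      using assms(3) that by (intro sum.cong) (auto simp: cinner_scaleC_left orthonormal_set_def)
    also have "\<dots> = cinner x f"
      using \<open>finite F\<close> that by simp
    finally show ?thesis by (simp add: cinner_diff_left)
  qed
  ultimately show ?thesis by blast
qed

text \<open>Greedy iteration of \<open>maximal_vector_exists\<close>. Infinite dimension keeps it
  from stopping: for \<open>a\<close> of finite rank it eventually continues inside the
  kernel.\<close>

lemma singular_vectors_exist:
  fixes a :: "'a::complex_hilbert_space \<Rightarrow> 'a"
  assumes inf: "\<not> (\<exists>B::'a set. finite B \<and> cspan B = UNIV)"
    and a: "a \<in> compact_operators"
  obtains e where "orthonormal e"
    "\<And>i. adj a (a (e i)) = scaleC (of_real ((norm (a (e i)))\<^sup>2)) (e i)"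
    "\<And>n x. (\<forall>i<n. cinner x (e i) = 0) \<Longrightarrow> norm (a x) \<le> norm (a (e n)) * norm x"
proof -
  \<comment> \<open>\<open>P\<close> is the invariant of the set of vectors found so far;
    \<open>Q F e\<close> says that \<open>e\<close> may be chosen next.\<close>
  define P where "P F \<longleftrightarrow> finite F \<and> orthonormal_set F \<and> (\<forall>f\<in>F. \<exists>l. adj a (a f) = scaleC l f)" for F
  define Q where "Q F e \<longleftrightarrow> norm e = 1 \<and> (\<forall>f\<in>F. cinner e f = 0) \<and>
    adj a (a e) = scaleC (of_real ((norm (a e))\<^sup>2)) e \<and>
    (\<forall>x. (\<forall>f\<in>F. cinner x f = 0) \<longrightarrow> norm (a x) \<le> norm (a e) * norm x)" for F e
  have "\<exists>e. Q F e" if F: "P F" for F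
  proof -
    obtain z where "z \<noteq> 0" "\<And>f. f \<in> F \<Longrightarrow> cinner z f = 0"
      using orthogonal_vector_exists[OF inf] F unfolding P_def by metis
    then show ?thesis
      unfolding Q_def using F by (intro maximal_vector_exists[OF a]) (auto simp: P_def)
  qed
  then obtain g where g: "\<And>F. P F \<Longrightarrow> Q F (g F)" by metis
  \<comment> \<open>The recursion accumulates the set of chosen vectors, and \<open>e n\<close> is
    the choice made for the set \<open>G n\<close>.\<close>
  define G where "G = rec_nat {} (\<lambda>_ F. insert (g F) F)"
  define e where "e n = g (G n)" for n
  have G_Suc: "G (Suc n) = insert (e n) (G n)" and G_0: "G 0 = {}" for n
    by (auto simp: G_def e_def)
  have G_eq: "G n = e ` {..<n}" for n
    by (induction n) (auto simp: G_0 G_Suc lessThan_Suc)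
  have "P (G n)" for n
  proof (induction n)
    case 0
    show ?case by (simp add: G_0 P_def orthonormal_set_def)
  next
    case (Suc n)
    then have Q: "Q (G n) (e n)" using g e_def by simp
    then have "cinner (e n) (e n) = 1" "e n \<notin> G n"
      using cinner_self[of "e n"] by (auto simp: Q_def)
    moreover have "cinner f (e n) = 0 \<and> cinner (e n) f = 0" if "f \<in> G n" for f
      using Q that cinner_eq_zero_commute by (auto simp: Q_def)
    ultimately show ?case
      using Suc Q by (auto simp: P_def Q_def G_Suc orthonormal_set_def)
  qed
  then have Q: "Q (e ` {..<n}) (e n)" for n
    using g e_def G_eq by metis
  have less: "cinner (e i) (e j) = 0" if "j < i" for i j
    using Q[of i] that by (auto simp: Q_def)
  have "orthonormal e"
    unfolding orthonormal_def
  proof (intro allI)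
    fix i j
    show "cinner (e i) (e j) = (if i = j then 1 else 0)"
      using Q[of i] less[of i j] less[of j i] cinner_eq_zero_commute[of "e i" "e j"]
      by (cases i j rule: linorder_cases) (auto simp: Q_def cinner_self)
  qed
  then show thesis
  proof (rule that)
    show "adj a (a (e i)) = scaleC (of_real ((norm (a (e i)))\<^sup>2)) (e i)" for i
      using Q[of i] unfolding Q_def by blast
    show "norm (a x) \<le> norm (a (e n)) * norm x" if "\<forall>i<n. cinner x (e i) = 0" for n x
      using Q[of n] that unfolding Q_def by blast
  qed
qed

section \<open>Positive square roots and the singular value decomposition\<close>

text \<open>Polarisation: the form is real at \<open>x + y\<close> and at
  \<open>x + scaleC \<i> y\<close>, and the cross terms there give the imaginary and the real part
  of the identity.\<close>

lemma positive_operator_selfadjoint: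
  assumes "positive_operator p"
  shows "cinner (p x) y = cinner x (p y)"
proof -
  have lin: "clinear p" and real: "\<And>z. Im (cinner (p z) z) = 0"
    using assms by (auto simp: positive_operator_def bounded_clinear_def complex_is_Real_iff)
  have "Im (cinner (p x) y) + Im (cinner (p y) x) = 0"
    using real[of "x + y"] real[of x] real[of y]
    by (simp add: clinear_add[OF lin] cinner_add_left cinner_add_right)
  moreover have "Re (cinner (p y) x) - Re (cinner (p x) y) = 0"
    using real[of "x + scaleC \<i> y"] real[of x] real[of y]
    by (simp add: clinear_add[OF lin] clinear_scaleC[OF lin] cinner_add_left cinner_add_right
        cinner_scaleC_left cinner_scaleC_right)
  ultimately have "cinner (p x) y = cnj (cinner (p y) x)"
    by (simp add: complex_eq_iff)
  then show ?thesis
    using cinner_commute by metis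
qed

text \<open>If \<open>p\<^sup>2 e = s\<^sup>2 e\<close> then \<open>v = p e - s e\<close> satisfies \<open>p v = - s v\<close>, so \<open>v = 0\<close> by positivity
  when \<open>s > 0\<close>.\<close>

lemma positive_sqrt_eigenvector:
  assumes p: "positive_operator p" and s: "0 \<le> s"
    and pp: "p (p e) = scaleC (of_real (s\<^sup>2)) e"
  shows "p e = scaleC (of_real s) e"
proof (cases "s = 0")
  case True
  have "cinner (p e) (p e) = 0"
    using positive_operator_selfadjoint[OF p, of e "p e"] pp True by simp
  then show ?thesis using True by (simp add: cinner_self_eq_zero)
next
  case False
  have lin: "clinear p" and nonneg: "\<And>z. 0 \<le> Re (cinner (p z) z)"
    using p by (auto simp: positive_operator_def bounded_clinear_def)
  let ?v = "p e - scaleC (of_real s) e"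
  have "p ?v = - scaleC (of_real s) ?v"
    by (simp add: clinear_diff[OF lin] clinear_scaleC[OF lin] pp complex_vector.scale_right_diff_distrib
        scaleC_scaleC power2_eq_square)
  then have "Re (cinner (p ?v) ?v) = - (s * (norm ?v)\<^sup>2)"
    by (simp add: cinner_minus_left cinner_scaleC_left cinner_self flip: of_real_power of_real_mult)
  then have "s * (norm ?v)\<^sup>2 \<le> 0"
    using nonneg[of ?v] by linarith
  then have "?v = 0"
    using False s by (simp add: mult_le_0_iff)
  then show ?thesis by simp
qed

text \<open>The diagonal operator on the singular vectors is the unique positive square root of
  \<open>a\<^sup>*a\<close>. The last two facts are the inputs to the Weyl--Fan inequality: the norm
  bound for the summands, orthogonality of the images for the sum. Indices of \<open>s\<close> start
  at 0, those of eigenvalues at 1.\<close>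

lemma singular_value_decomposition:
  fixes a :: "'a::complex_hilbert_space \<Rightarrow> 'a"
  assumes inf: "\<not> (\<exists>B::'a set. finite B \<and> cspan B = UNIV)"
    and a: "a \<in> compact_operators"
  obtains e s where "orthonormal e" "decseq s" "\<And>i. 0 \<le> s i" "s \<longlonglongrightarrow> 0"
    "\<And>i. eigenvalue (operator_abs a) i = s (i - 1)"
    "\<And>n x. (\<forall>i<n. cinner x (e i) = 0) \<Longrightarrow> norm (a x) \<le> s n * norm x"
    "\<And>i j. cinner (a (e i)) (a (e j)) = (if i = j then of_real ((s i)\<^sup>2) else 0)"
proof -
  obtain e where e: "orthonormal e"
    and eig: "\<And>i. adj a (a (e i)) = scaleC (of_real ((norm (a (e i)))\<^sup>2)) (e i)"
    and max: "\<And>n x. (\<forall>i<n. cinner x (e i) = 0) \<Longrightarrow> norm (a x) \<le> norm (a (e n)) * norm x"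
    by (rule singular_vectors_exist[OF inf a]) (rule that)
  have bdd: "bounded_clinear a" by (rule compact_operator_bounded[OF a])
  then have lin: "clinear a"
    unfolding bounded_clinear_def by blast
  have cont_adj: "bounded_linear (adj a)" by (rule adj_bounded_linear[OF bdd])
  define s where "s i = norm (a (e i))" for i
  have orth: "cinner (a (e i)) (a (e j)) = (if i = j then of_real ((s i)\<^sup>2) else 0)" for i j
    using eig[of i] cinner_adj_comp(1)[OF bdd, of "e i" "e j"]
    by (auto simp: s_def cinner_self cinner_scaleC_left orthonormal_cinner[OF e])
  have "s n \<le> s m" if "m \<le> n" for m n
    using max[of m "e n"] that by (simp add: s_def orthonormal_cinner[OF e] orthonormal_norm[OF e])
  then have dec: "decseq s" by (simp add: decseq_def)
  have null: "s \<longlonglongrightarrow> 0"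
  proof -
    obtain l and r :: "nat \<Rightarrow> nat" where r: "strict_mono r" and l: "(\<lambda>n. a (e (r n))) \<longlonglongrightarrow> l"
      by (rule compact_operator_subseq[OF a, of e]) (simp_all add: orthonormal_norm[OF e])
    \<comment> \<open>The images are orthogonal, so the squared distance of consecutive terms, which
      tends to 0, is the sum of their squared norms.\<close>
    have "(\<lambda>n. (norm (a (e (r n)) - a (e (r (Suc n)))))\<^sup>2) \<longlonglongrightarrow> (norm (l - l))\<^sup>2"
      by (intro tendsto_intros l LIMSEQ_Suc[OF l])
    moreover have "(norm (a (e (r n)) - a (e (r (Suc n)))))\<^sup>2 = (s (r n))\<^sup>2 + (s (r (Suc n)))\<^sup>2" for n
      using strict_mono_less[OF r, of n "Suc n"] unfolding power2_norm_diff orth by (auto simp: s_def)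
    ultimately have "(\<lambda>n. (s (r n))\<^sup>2 + (s (r (Suc n)))\<^sup>2) \<longlonglongrightarrow> 0" by simp
    then have "(\<lambda>n. (s (r n))\<^sup>2) \<longlonglongrightarrow> 0"
      by (rule tendsto_sandwich[OF _ _ tendsto_const[of 0], rotated 2]) auto
    then have sub: "(\<lambda>n. s (r n)) \<longlonglongrightarrow> 0"
      using tendsto_real_sqrt[of "\<lambda>n. (s (r n))\<^sup>2" 0] by (simp add: s_def)
    obtain L where L: "s \<longlonglongrightarrow> L"
      using decseq_convergent[OF dec, of 0] by (auto simp: s_def)
    have "L = 0"
      using LIMSEQ_subseq_LIMSEQ[OF L r] sub LIMSEQ_unique by (auto simp: o_def)
    then show ?thesis using L by simp
  qed
  interpret null_diagonal e s
    using e dec null by unfold_locales (simp_all add: s_def)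
  let ?P = "\<lambda>n x. \<Sum>i<n. scaleC (cinner x (e i)) (e i)"
  \<comment> \<open>The remainder is orthogonal to the first \<open>n\<close> singular vectors, so
    maximality bounds its image by \<open>s n\<close>. Thus the values on \<open>e\<close> determine
    \<open>a\<close> everywhere, even if \<open>e\<close> does not span the space.\<close>
  have tail: "(\<lambda>n. a (x - ?P n x)) \<longlonglongrightarrow> 0" for x
  proof (rule Lim_null_comparison)
    have "norm (a (x - ?P n x)) \<le> s n * norm x" for n
    proof -
      have "norm (a (x - ?P n x)) \<le> s n * norm (x - ?P n x)"
        unfolding s_def by (rule max) (simp add: cinner_diff_left cinner_orthonormal_sum[OF e])
      also have "\<dots> \<le> s n * norm x"
        by (intro mult_left_mono norm_minus_orthonormal_sum_le[OF e]) (simp_all add: s_def)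
      finally show ?thesis .
    qed
    then show "\<forall>\<^sub>F n in sequentially. norm (a (x - ?P n x)) \<le> s n * norm x"
      by (simp add: always_eventually)
    show "(\<lambda>n. s n * norm x) \<longlonglongrightarrow> 0"
      using tendsto_mult_right[OF null, of "norm x"] by simp
  qed
  have D_D: "D (D x) = adj a (a x)" for x
  proof -
    have "adj a (a x) - adj a (a (x - ?P n x)) = (\<Sum>i<n. scaleC (of_real ((s i)\<^sup>2) * cinner x (e i)) (e i))" for n
    proof -
      have "adj a (a x) - adj a (a (x - ?P n x)) = adj a (a (?P n x))"
        by (simp add: clinear_diff[OF lin] linear_simps(2)[OF cont_adj])
      also have "\<dots> = (\<Sum>i<n. adj a (a (scaleC (cinner x (e i)) (e i))))"
        by (simp only: clinear_sum[OF lin] linear_sum[OF bounded_linear.linear[OF cont_adj]])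
      also have "\<dots> = (\<Sum>i<n. scaleC (of_real ((s i)\<^sup>2) * cinner x (e i)) (e i))"
      proof (rule sum.cong[OF refl])
        fix i
        have scale: "adj a (scaleC c y) = scaleC c (adj a y)" for c y
          by (rule cinner_eqI) (simp add: cinner_scaleC_right flip: adj_cinner[OF bdd])
        show "adj a (a (scaleC (cinner x (e i)) (e i))) = scaleC (of_real ((s i)\<^sup>2) * cinner x (e i)) (e i)"
          by (simp add: clinear_scaleC[OF lin] scale eig scaleC_scaleC s_def mult.commute)
      qed
      finally show ?thesis .
    qed
    moreover have "(\<lambda>n. adj a (a x) - adj a (a (x - ?P n x))) \<longlonglongrightarrow> adj a (a x) - 0"
      using bounded_linear.tendsto[OF cont_adj tail[of x]]
      by (intro tendsto_diff tendsto_const) (simp add: linear_simps(3)[OF cont_adj])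
    ultimately have "(\<lambda>i. scaleC (of_real ((s i)\<^sup>2) * cinner x (e i)) (e i)) sums adj a (a x)"
      by (simp add: sums_def)
    then show ?thesis
      by (rule sums_unique2[OF sums_D_D])
  qed
  have "operator_abs a = D"
    unfolding operator_abs_def operator_sqrt_def
  proof (rule the_equality)
    show "positive_operator D \<and> D \<circ> D = adj a \<circ> a"
      using positive_D D_D by auto
    fix p assume "positive_operator p \<and> p \<circ> p = adj a \<circ> a"
    then have p: "positive_operator p" and pp: "\<And>x. p (p x) = adj a (a x)"
      by (auto simp: fun_eq_iff)
    have lin_p: "clinear p"
      using p by (simp add: positive_operator_def bounded_clinear_def)
    have p_e: "p (e i) = scaleC (of_real (s i)) (e i)" for i
      using pp eig by (intro positive_sqrt_eigenvector[OF p]) (simp_all add: s_def)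
    \<comment> \<open>Equality of norms transfers \<open>tail\<close> from \<open>a\<close> to
      \<open>p\<close>, which extends the agreement of \<open>p\<close> and \<open>D\<close> from
      the vectors \<open>e i\<close> to all \<open>x\<close>.\<close>
    have norm_p: "norm (p x) = norm (a x)" for x
    proof -
      have "cinner (p x) (p x) = cinner x (adj a (a x))"
        using positive_operator_selfadjoint[OF p, of x "p x"] by (simp add: pp)
      also have "\<dots> = cinner (a x) (a x)" by (simp add: cinner_adj_comp[OF bdd])
      finally show ?thesis by (simp add: norm_eq_sqrt_cinner)
    qed
    show "p = D"
    proof
      fix x
      have "(\<lambda>n. norm (p (x - ?P n x))) \<longlonglongrightarrow> 0"
        unfolding norm_p using tail by (rule tendsto_norm_zero)
      then have "(\<lambda>n. p x - p (x - ?P n x)) \<longlonglongrightarrow> p x - 0"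
        by (intro tendsto_diff tendsto_const) (rule tendsto_norm_zero_cancel)
      moreover have "p x - p (x - ?P n x) = (\<Sum>i<n. scaleC (of_real (s i) * cinner x (e i)) (e i))" for n
        by (simp add: clinear_diff[OF lin_p] clinear_sum[OF lin_p] clinear_scaleC[OF lin_p] p_e
            scaleC_scaleC mult.commute)
      ultimately have "(\<lambda>i. scaleC (of_real (s i) * cinner x (e i)) (e i)) sums p x"
        by (simp add: sums_def)
      then show "p x = D x"
        using sums_D by (rule sums_unique2)
    qed
  qed
  then have "eigenvalue (operator_abs a) i = s (i - 1)" for i
    using eigenvalue_eq[OF is_eigenvalue_sequence_D] by simp
  then show thesis
    using that[OF e dec nonneg null _ _ orth] max unfolding s_def by blast
qed

section \<open>The Weyl--Fan inequality\<close>

text \<open>The map \<open>x \<mapsto> \<Sum>j<N. \<langle>x, h j\<rangle> e j\<close> sends the \<open>N + 1\<close> independent vectors \<open>e 0, \<dots>, e N\<close> into an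
  \<open>N\<close>-dimensional space, so it has a nontrivial kernel.\<close>

lemma orthogonal_combination_exists:
  fixes e :: "nat \<Rightarrow> 'a::complex_hilbert_space"
  assumes e: "orthonormal e"
  shows "\<exists>u. (\<Sum>i\<le>N. scaleC (u i) (e i)) \<noteq> 0 \<and>
    (\<forall>j<N. cinner (\<Sum>i\<le>N. scaleC (u i) (e i)) (h j) = 0)"
proof -
  \<comment> \<open>With the orthonormal \<open>e j\<close> as target vectors, the inner products
    with \<open>h j\<close> can be read off as coefficients of \<open>L x\<close>.\<close>
  define L where "L x = (\<Sum>j<N. scaleC (cinner x (h j)) (e j))" for x
  let ?B = "e ` {..N}"
  have lin: "clinear L"
    unfolding clinear_iff L_def
    by (simp add: cinner_add_left cinner_scaleC_left scaleC_add_left sum.distrib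
        complex_vector.scale_sum_right scaleC_scaleC)
  interpret L: Vector_Spaces.linear scaleC scaleC L by (rule lin)
  have "\<not> inj_on L (cspan ?B)"
  proof
    assume inj: "inj_on L (cspan ?B)"
    then have "complex_vector.independent (L ` ?B)"
      by (intro L.independent_injective_image[folded cspan_def] orthonormal_independent[OF e])
    moreover have "L ` ?B \<subseteq> cspan (e ` {..<N})"
      unfolding L_def
      by (intro image_subsetI complex_vector.span_sum complex_vector.span_scale complex_vector.span_base)
        auto
    ultimately have "card (L ` ?B) \<le> card (e ` {..<N})"
      using complex_vector.independent_span_bound[of "e ` {..<N}"] by blast
    also have "\<dots> \<le> N" using card_image_le[of "{..<N}" e] by simp
    finally have "card (L ` ?B) \<le> N" .
    moreover have "card (L ` ?B) = Suc N"
      using card_image[OF inj_on_subset[OF inj complex_vector.span_superset]]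
        card_image[OF inj_on_subset[OF orthonormal_inj[OF e] subset_UNIV], of "{..N}"] by simp
    ultimately show False by simp
  qed
  then obtain x y where xy: "x \<in> cspan ?B" "y \<in> cspan ?B" "x \<noteq> y" "L x = L y"
    by (auto simp: inj_on_def)
  then have "x - y \<in> cspan ?B" by (intro complex_vector.span_diff)
  then obtain c where "x - y = (\<Sum>v\<in>?B. scaleC (c v) v)"
    using complex_vector.span_finite[of ?B] by auto
  also have "\<dots> = (\<Sum>i\<le>N. scaleC (c (e i)) (e i))"
    by (simp add: sum.reindex[OF inj_on_subset[OF orthonormal_inj[OF e] subset_UNIV]])
  finally have eq: "x - y = (\<Sum>i\<le>N. scaleC (c (e i)) (e i))" .
  have "L (x - y) = 0" using xy by (simp add: clinear_diff[OF lin])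
  then have "cinner (x - y) (h j) = 0" if "j < N" for j
    using cinner_orthonormal_sum[OF e, of "{..<N}" "\<lambda>j. cinner (x - y) (h j)" j] that
    by (simp add: L_def)
  then have "x - y \<noteq> 0 \<and> (\<forall>j<N. cinner (x - y) (h j) = 0)"
    using xy(3) by simp
  then show ?thesis
    unfolding eq by (rule exI[of _ "\<lambda>i. c (e i)"])
qed

text \<open>The Weyl--Fan inequality: some nonzero combination of \<open>e 0, \<dots>, e (m + n)\<close> is orthogonal to the
  \<open>m\<close> vectors \<open>f i\<close> and the \<open>n\<close> vectors \<open>g i\<close>.\<close>

lemma singular_value_add_le:
  fixes b c :: "'a::complex_hilbert_space \<Rightarrow> 'a"
  assumes lin: "clinear (\<lambda>x. b x + c x)"
    and f: "\<And>x. (\<forall>i<m. cinner x (f i) = 0) \<Longrightarrow> norm (b x) \<le> B * norm x"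
    and g: "\<And>x. (\<forall>i<n. cinner x (g i) = 0) \<Longrightarrow> norm (c x) \<le> C * norm x"
    and e: "orthonormal e"
    and s: "decseq s" "\<And>i. 0 \<le> s i"
    and orth: "\<And>i j. cinner (b (e i) + c (e i)) (b (e j) + c (e j)) = (if i = j then of_real ((s i)\<^sup>2) else 0)"
  shows "s (m + n) \<le> B + C"
proof -
  define h where "h j = (if j < m then f j else g (j - m))" for j
  obtain u where u: "(\<Sum>i\<le>m + n. scaleC (u i) (e i)) \<noteq> 0"
      "\<And>j. j < m + n \<Longrightarrow> cinner (\<Sum>i\<le>m + n. scaleC (u i) (e i)) (h j) = 0"
    using orthogonal_combination_exists[OF e, of "m + n" h] by blast
  define x where "x = (\<Sum>i\<le>m + n. scaleC (u i) (e i))"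
  have "cinner x (f i) = 0" if "i < m" for i
    using u(2)[of i] that by (simp add: h_def x_def)
  moreover have "cinner x (g i) = 0" if "i < n" for i
    using u(2)[of "m + i"] that by (simp add: h_def x_def)
  ultimately have upper: "norm (b x + c x) \<le> (B + C) * norm x"
    using norm_triangle_le[of "b x" "c x"] f[of x] g[of x] by (simp add: distrib_right)
  \<comment> \<open>Lower bound: on combinations of \<open>e 0, ..., e (m + n)\<close> the sum
    operator stretches lengths by at least \<open>s (m + n)\<close>, the smallest of the entries
    involved.\<close>
  have "(s (m + n))\<^sup>2 * (norm x)\<^sup>2 = (\<Sum>i\<le>m + n. (s (m + n))\<^sup>2 * (cmod (u i))\<^sup>2)"
    by (simp add: x_def norm_orthonormal_sum[OF e] sum_distrib_left)
  also have "\<dots> \<le> (\<Sum>i\<le>m + n. (s i)\<^sup>2 * (cmod (u i))\<^sup>2)"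
    using s by (intro sum_mono mult_right_mono power_mono) (auto dest: decseqD)
  also have "\<dots> = (norm (\<Sum>i\<le>m + n. scaleC (u i) (b (e i) + c (e i))))\<^sup>2"
    by (rule norm_orthogonal_sum[symmetric]) (auto simp: orth)
  also have "(\<Sum>i\<le>m + n. scaleC (u i) (b (e i) + c (e i))) = b x + c x"
    unfolding x_def by (simp only: clinear_sum[OF lin] clinear_scaleC[OF lin])
  finally have "(s (m + n) * norm x)\<^sup>2 \<le> (norm (b x + c x))\<^sup>2"
    by (simp add: power_mult_distrib)
  then have "s (m + n) * norm x \<le> norm (b x + c x)"
    by (rule power2_le_imp_le) simp
  then have "s (m + n) * norm x \<le> (B + C) * norm x"
    using upper by linarith
  then show ?thesis
    using u(1) by (simp add: x_def)
qed

section \<open>The triangle inequality\<close>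

text \<open>Concavity makes the increments decrease, so \<open>n\<close> steps starting from
  \<open>m\<close> gain no more than \<open>n\<close> steps starting from 0.\<close>

lemma concave_subadditive:
  fixes \<alpha> :: "nat \<Rightarrow> real"
  assumes "\<alpha> 0 = 0" and concave: "\<And>i. i \<ge> 1 \<Longrightarrow> (\<alpha> (i + 1) + \<alpha> (i - 1)) / 2 \<le> \<alpha> i"
  shows "\<alpha> (m + n) \<le> \<alpha> m + \<alpha> n"
proof -
  have "\<alpha> (Suc (Suc k)) - \<alpha> (Suc k) \<le> \<alpha> (Suc k) - \<alpha> k" for k
    using concave[of "Suc k"] by simp
  then have "decseq (\<lambda>k. \<alpha> (Suc k) - \<alpha> k)"
    by (simp add: decseq_Suc_iff)
  then have incr: "\<alpha> (Suc (m + k)) - \<alpha> (m + k) \<le> \<alpha> (Suc k) - \<alpha> k" for k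
    using decseqD[of _ k "m + k"] by fastforce
  show ?thesis
  proof (induction n)
    case (Suc n)
    then show ?case using incr[of n] by simp
  qed (simp add: assms(1))
qed

text \<open>For decreasing \<open>s\<close> the witness \<open>m\<close> counts the entries of \<open>s\<close> exceeding \<open>B\<close>.\<close>

lemma sugeno_crossover:
  fixes s \<alpha> :: "nat \<Rightarrow> real"
  assumes "s \<longlonglongrightarrow> 0" "\<And>i. 0 \<le> \<alpha> i" "\<alpha> 0 = 0" "\<alpha> 1 > 0" "0 \<le> B"
    and le: "\<And>i. min (s i) (\<alpha> (Suc i)) \<le> B"
  shows "\<exists>m. s m \<le> B \<and> \<alpha> m \<le> B"
proof -
  have ex: "\<exists>m. s m \<le> B"
  proof (cases "B = 0")
    \<comment> \<open>Convergence to 0 alone need not produce an entry \<open>\<le> 0\<close>; here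
      \<open>\<alpha> 1 > 0\<close> forces \<open>s 0 \<le> 0\<close>.\<close>
    case True
    then show ?thesis using le[of 0] \<open>\<alpha> 1 > 0\<close> by (auto simp: min_le_iff_disj)
  next
    case False
    then have "eventually (\<lambda>i. s i < B) sequentially"
      using assms(1,5) by (intro order_tendstoD) auto
    then show ?thesis
      using eventually_happens[of _ sequentially] by (auto intro: less_imp_le)
  qed
  let ?m = "LEAST m. s m \<le> B"
  have "s ?m \<le> B" using ex by (rule LeastI_ex)
  moreover have "\<alpha> ?m \<le> B"
  proof (cases ?m)
    \<comment> \<open>By minimality \<open>s k > B\<close>, so the bound on the minimum at
      \<open>k\<close> must come from \<open>\<alpha> (Suc k)\<close>, which is
      \<open>\<alpha> ?m\<close>.\<close>
    case (Suc k)
    then have "\<not> s k \<le> B" using not_less_Least[of k "\<lambda>m. s m \<le> B"] by simp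
    then show ?thesis using le[of k] Suc by (simp add: min_le_iff_disj)
  qed (simp add: assms)
  ultimately show ?thesis by blast
qed

text \<open>These translate between the supremum over \<open>i \<ge> 1\<close> and sequences
  starting at 0. The family is bounded by \<open>s 0\<close>, as the conditional supremum
  demands.\<close>

lemma
  fixes \<alpha> s :: "nat \<Rightarrow> real"
  assumes eig: "\<And>i. eigenvalue (operator_abs a) i = s (i - 1)" and s: "decseq s" "\<And>i. 0 \<le> s i"
  shows sugeno_norm_upper: "min (s i) (\<alpha> (Suc i)) \<le> sugeno_norm \<alpha> a"
    and sugeno_norm_leI: "(\<And>i. min (s i) (\<alpha> (Suc i)) \<le> B) \<Longrightarrow> sugeno_norm \<alpha> a \<le> B"
proof -
  have eq: "sugeno_norm \<alpha> a = (SUP i\<in>{1..}. min (s (i - 1)) (\<alpha> i))"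
    by (simp add: sugeno_norm_def sugeno_trace_def eig)
  have "bdd_above ((\<lambda>i. min (s (i - 1)) (\<alpha> i)) ` {1..})"
    using decseqD[OF s(1), of 0] by (intro bdd_aboveI2[where M = "s 0"]) (simp add: min.coboundedI1)
  then have "min (s (Suc i - 1)) (\<alpha> (Suc i)) \<le> sugeno_norm \<alpha> a"
    unfolding eq by (intro cSUP_upper) simp_all
  then show "min (s i) (\<alpha> (Suc i)) \<le> sugeno_norm \<alpha> a" by simp
  assume le: "\<And>i. min (s i) (\<alpha> (Suc i)) \<le> B"
  show "sugeno_norm \<alpha> a \<le> B"
    unfolding eq
  proof (rule cSUP_least)
    fix i :: nat assume "i \<in> {1..}"
    then show "min (s (i - 1)) (\<alpha> i) \<le> B" using le[of "i - 1"] by simp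
  qed simp
qed

theorem theorem6p4:
  fixes \<alpha> :: "nat \<Rightarrow> real"
    and b c :: "'h::complex_hilbert_space \<Rightarrow> 'h"
  assumes separable: "\<exists>D::'h set. countable D \<and> closure D = UNIV"
    and infinite_dimensional: "\<not> (\<exists>B::'h set. finite B \<and> cspan B = UNIV)"
    and "\<And>i. 0 \<le> \<alpha> i"
    and "mono \<alpha>"
    and "\<alpha> 0 = 0"
    and "\<alpha> 1 > 0"
    and concave: "\<And>i. i \<ge> 1 \<Longrightarrow> (\<alpha> (i + 1) + \<alpha> (i - 1)) / 2 \<le> \<alpha> i"
    and "b \<in> compact_operators"
    and "c \<in> compact_operators"
  shows "sugeno_norm \<alpha> (\<lambda>x. b x + c x) \<le> sugeno_norm \<alpha> b + sugeno_norm \<alpha> c"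
proof -
  note svd = singular_value_decomposition[OF infinite_dimensional]
  have bc: "(\<lambda>x. b x + c x) \<in> compact_operators"
    by (intro compact_operator_add assms)
  obtain e s where e: "orthonormal e" and s: "decseq s" "\<And>i. 0 \<le> s i"
    and s_eig: "\<And>i. eigenvalue (operator_abs (\<lambda>x. b x + c x)) i = s (i - 1)"
    and orth: "\<And>i j. cinner (b (e i) + c (e i)) (b (e j) + c (e j)) = (if i = j then of_real ((s i)\<^sup>2) else 0)"
    by (rule svd[OF bc]) (rule that)
  obtain f p where p: "decseq p" "\<And>i. 0 \<le> p i" and p_null: "p \<longlonglongrightarrow> 0"
    and p_eig: "\<And>i. eigenvalue (operator_abs b) i = p (i - 1)"
    and f: "\<And>m x. (\<forall>i<m. cinner x (f i) = 0) \<Longrightarrow> norm (b x) \<le> p m * norm x"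
    by (rule svd[OF \<open>b \<in> compact_operators\<close>]) (rule that)
  obtain g q where q: "decseq q" "\<And>i. 0 \<le> q i" and q_null: "q \<longlonglongrightarrow> 0"
    and q_eig: "\<And>i. eigenvalue (operator_abs c) i = q (i - 1)"
    and g: "\<And>n x. (\<forall>i<n. cinner x (g i) = 0) \<Longrightarrow> norm (c x) \<le> q n * norm x"
    by (rule svd[OF \<open>c \<in> compact_operators\<close>]) (rule that)
  let ?B = "sugeno_norm \<alpha> b" and ?C = "sugeno_norm \<alpha> c"
  have b_le: "min (p i) (\<alpha> (Suc i)) \<le> ?B" for i by (rule sugeno_norm_upper[OF p_eig p])
  have c_le: "min (q i) (\<alpha> (Suc i)) \<le> ?C" for i by (rule sugeno_norm_upper[OF q_eig q])
  have "0 \<le> ?B" "0 \<le> ?C"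
    using b_le[of 0] c_le[of 0] p(2)[of 0] q(2)[of 0] assms(3)[of "Suc 0"]
    by (auto simp: min_def split: if_splits)
  then obtain m n where m: "p m \<le> ?B" "\<alpha> m \<le> ?B" and n: "q n \<le> ?C" "\<alpha> n \<le> ?C"
    using sugeno_crossover[OF p_null assms(3,5,6) _ b_le] sugeno_crossover[OF q_null assms(3,5,6) _ c_le]
    by metis
  have "clinear (\<lambda>x. b x + c x)"
    using bc by (simp add: compact_operators_def)
  then have "s (m + n) \<le> p m + q n"
    by (rule singular_value_add_le[OF _ f g e s orth])
  then have s_le: "s (m + n) \<le> ?B + ?C"
    using m n by linarith
  have \<alpha>_le: "\<alpha> (m + n) \<le> ?B + ?C"
    using concave_subadditive[OF \<open>\<alpha> 0 = 0\<close> concave, of m n] m n by linarith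
  show ?thesis
  proof (rule sugeno_norm_leI[OF s_eig s])
    fix i
    show "min (s i) (\<alpha> (Suc i)) \<le> ?B + ?C"
    \<comment> \<open>Entry \<open>i\<close> is the singular value number \<open>i + 1\<close>.
      Below \<open>m + n\<close> the minimum is controlled through
      \<open>\<alpha> (Suc i) \<le> \<alpha> (m + n)\<close>, from there on through
      \<open>s i \<le> s (m + n)\<close>.\<close>
    proof (cases "i < m + n")
      case True
      then show ?thesis
        using monoD[OF \<open>mono \<alpha>\<close>, of "Suc i" "m + n"] \<alpha>_le by (simp add: min.coboundedI2)
    next
      case False
      then show ?thesis
        using decseqD[OF s(1), of "m + n" i] s_le by (simp add: min.coboundedI1)
    qed
  qed
qed

end
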